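(* Let $\nu>0$ and let $(\rho,u)$ (with associated potential $\phi$) be a global classical solution of $$\begin{cases}\partial_t\rho+\partial_x(\rho u)=0,\\ \partial_t u+u\,\partial_x u=-\nu u-\partial_x\phi,\\ -\partial_{x}^2\phi=\rho-e^{\phi},\end{cases}\qquad (t,x)\in\mathbb{R}_+\times\mathbb{T},$$ with unit mass $\int_{\mathbb{T}}\rho\,dx=1$ (so that $\int_{\mathbb{T}}(e^{\phi}-1)\,dx=0$). Assume that $$0<\rho_-\le\rho(t,x)\le\rho_+<+\infty,\qquad \|\partial_x u\|_{L^\infty(\mathbb{T}\times\mathbb{R}_+)}\le M<+\infty$$ for some constants $\rho_-,\rho_+,M>0$. Then, for all $t\ge0$, $$\|(\rho-1,\;u,\;\partial_x u,\;\partial_x\phi,\;\partial_x^2\phi,\;e^{\phi}-1)(t,\cdot)\|_{L^\infty(\mathbb{T})}\le Ce^{-rt}$$ for some $C,r>0$ depending only on $\nu,\rho_\pm,M$ and $\mathcal{E}(0)$, where $\mathcal{E}$ is the free energy.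
   Context: $\mathbb{T}=[-\tfrac12,\tfrac12)$ is the one-dimensional periodic domain (all functions of $x$ are 1-periodic), and $\mathbb{R}_+$ is the time half-line $t\ge 0$. A global classical solution is one satisfying the system pointwise (with derivatives in the classical sense) for all $t>0$, subject to initial data $(\rho,u)(0,\cdot)=(\rho_0,u_0)$. The free energy is $$\mathcal{E}(t):=\int_{\mathbb{T}}\Big(\tfrac12\rho u^2+\tfrac12(\partial_x\phi)^2+e^{\phi}(\phi-1)+1\Big)\,dx.$$ The $L^\infty$ norm of a tuple of functions is the sum (equivalently, maximum) of the $L^\infty$ norms of its components; $\rho_\pm$ abbreviates $\rho_-,\rho_+$. *)

theory Defs
  imports "HOL-Analysis.Analysis" "HOL-Probability.Essential_Supremum"
begin

text \<open>Space-time functions are curried, time first: \<open>f t x\<close>.  Functions on the torus are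
  1-periodic functions of a real variable; values at negative times are irrelevant.\<close>

definition torus :: "real set" where
  "torus = {-1/2..<1/2}"

definition partial_t :: "(real \<Rightarrow> real \<Rightarrow> real) \<Rightarrow> real \<Rightarrow> real \<Rightarrow> real" where
  "partial_t f t x = deriv (\<lambda>s. f s x) t"

definition partial_x :: "(real \<Rightarrow> real \<Rightarrow> real) \<Rightarrow> real \<Rightarrow> real \<Rightarrow> real" where
  "partial_x f t x = deriv (\<lambda>y. f t y) x"

definition jointly_continuous :: "real set \<Rightarrow> (real \<Rightarrow> real \<Rightarrow> real) \<Rightarrow> bool" where
  "jointly_continuous I f \<longleftrightarrow> continuous_on (I \<times> UNIV) (\<lambda>(t, x). f t x)"

definition differentiable_t :: "real set \<Rightarrow> (real \<Rightarrow> real \<Rightarrow> real) \<Rightarrow> bool" where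
  "differentiable_t I f \<longleftrightarrow> (\<forall>t\<in>I. \<forall>x. (\<lambda>s. f s x) differentiable (at t))"

definition differentiable_x :: "real set \<Rightarrow> (real \<Rightarrow> real \<Rightarrow> real) \<Rightarrow> bool" where
  "differentiable_x I f \<longleftrightarrow> (\<forall>t\<in>I. \<forall>x. (\<lambda>y. f t y) differentiable (at x))"

definition C1_spacetime :: "real set \<Rightarrow> (real \<Rightarrow> real \<Rightarrow> real) \<Rightarrow> bool" where
  "C1_spacetime I f \<longleftrightarrow>
     differentiable_t I f \<and> differentiable_x I f \<and>
     jointly_continuous I (partial_t f) \<and> jointly_continuous I (partial_x f)"

text \<open>The evolution equations hold for \<open>t > 0\<close>, where \<open>\<rho>\<close> and \<open>u\<close> are continuously
  differentiable.  The initial data are \<open>\<rho> 0\<close> and \<open>u 0\<close>, attained continuously.  The quantities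
  \<open>\<partial>\<^sub>x u\<close>, \<open>\<partial>\<^sub>x \<phi>\<close> and \<open>\<partial>\<^sub>x\<^sup>2 \<phi>\<close> are required to exist and be continuous up to \<open>t = 0\<close>,
  because they are evaluated there.  No differentiability of \<open>\<phi>\<close> in time is assumed: \<open>\<phi>\<close> is
  determined by \<open>\<rho>\<close> at each time through the elliptic equation.\<close>

definition classical_solution ::
  "real \<Rightarrow> (real \<Rightarrow> real \<Rightarrow> real) \<Rightarrow> (real \<Rightarrow> real \<Rightarrow> real) \<Rightarrow> (real \<Rightarrow> real \<Rightarrow> real) \<Rightarrow> bool"
where
  "classical_solution \<nu> \<rho> u \<phi> \<longleftrightarrow>
     (\<forall>t\<ge>0. \<forall>x. \<rho> t (x + 1) = \<rho> t x \<and> u t (x + 1) = u t x \<and> \<phi> t (x + 1) = \<phi> t x) \<and>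
     jointly_continuous {0..} \<rho> \<and>
     jointly_continuous {0..} u \<and> differentiable_x {0..} u \<and>
     jointly_continuous {0..} (partial_x u) \<and>
     jointly_continuous {0..} \<phi> \<and> differentiable_x {0..} \<phi> \<and>
     jointly_continuous {0..} (partial_x \<phi>) \<and> differentiable_x {0..} (partial_x \<phi>) \<and>
     jointly_continuous {0..} (partial_x (partial_x \<phi>)) \<and>
     C1_spacetime {0<..} \<rho> \<and> C1_spacetime {0<..} u \<and>
     (\<forall>t>0. \<forall>x. partial_t \<rho> t x + partial_x (\<lambda>s y. \<rho> s y * u s y) t x = 0) \<and>
     (\<forall>t>0. \<forall>x. partial_t u t x + u t x * partial_x u t x = - \<nu> * u t x - partial_x \<phi> t x) \<and>
     (\<forall>t\<ge>0. \<forall>x. - partial_x (partial_x \<phi>) t x = \<rho> t x - exp (\<phi> t x))"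

definition free_energy ::
  "(real \<Rightarrow> real \<Rightarrow> real) \<Rightarrow> (real \<Rightarrow> real \<Rightarrow> real) \<Rightarrow> (real \<Rightarrow> real \<Rightarrow> real) \<Rightarrow> real \<Rightarrow> real"
where
  "free_energy \<rho> u \<phi> t =
     (LBINT x:torus. (1/2 * \<rho> t x * (u t x)\<^sup>2 + 1/2 * (partial_x \<phi> t x)\<^sup>2
        + exp (\<phi> t x) * (\<phi> t x - 1) + 1))"

text \<open>\<open>esssup\<close> is \<open>\<infinity>\<close> on non-measurable functions, so a finite bound on \<open>Linfty_norm\<close>
  includes measurability.\<close>

definition Linfty_norm :: "'a::euclidean_space set \<Rightarrow> ('a \<Rightarrow> real) \<Rightarrow> ereal" where
  "Linfty_norm A f = esssup (lebesgue_on A) (\<lambda>z. ereal \<bar>f z\<bar>)"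

definition Linfty_norm_tuple :: "'a::euclidean_space set \<Rightarrow> ('a \<Rightarrow> real) list \<Rightarrow> ereal" where
  "Linfty_norm_tuple A fs = (\<Sum>f\<leftarrow>fs. Linfty_norm A f)"

end

(* The potential is controlled by the energy method. Along solutions the free energy dissipates only
   the kinetic part, so the cross term eps * int rho u phi_x is added; its derivative produces
   - eps * int rho phi_x^2, and the result is equivalent to the free energy and decays exponentially.
   Since phi need not be differentiable in time, the differential inequality is obtained for the upper
   Dini derivative, from the Poisson equation at two times subtracted from each other.

   The energy gives no pointwise control of rho and u_x. For these, follow two characteristics
   enclosing a fixed mass m. Their distance D satisfies D'' + nu D' + D = m + o(1) m, so D / m - 1 and
   D' / m decay at a rate independent of m; letting the two characteristics merge, D / m and D' / m
   become 1 / rho and u_x / rho. *)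
theory Submission
  imports Defs
begin

section \<open>A comparison principle and one-periodic functions\<close>

text \<open>The solution is only C^1, so the momentum equation cannot be differentiated in x to
  obtain an equation for u_x. Formally, along a characteristic, p = 1/\<rho> - 1 and w = u_x/\<rho>
  satisfy p' = w and w' = - \<nu> w - p - (e^\<phi> - 1)/\<rho>: division by \<rho> turns the
  Poisson source \<rho> into the constant 1, so the system is linear however far \<rho> is from 1.
  Finite mass increments are the difference form of this system and use first derivatives only. From
  the potential they ask for uniform decay of e^\<phi> - 1. The energy supplies it because
  neutrality forces \<phi> to vanish somewhere, so that the integral of \<phi>_x^2 bounds \<phi>^2
  pointwise.

  The stream function \<open>F\<close> serves twice. Its level curves are the characteristics, so no
  flow has to be constructed. And since F_x = \<rho> and F_t = - \<rho> u, an increment of \<phi>_x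
  in time is bounded in L^2 by the increment of \<open>F\<close>, which is of first order in the
  time step even if \<phi> has no time derivative.\<close>

lemma Dini_nonincreasing:
  fixes z :: "real \<Rightarrow> real"
  assumes ab: "a \<le> b" and cont: "continuous_on {a..b} z"
    and dini: "\<And>t \<eta>. \<lbrakk>a \<le> t; t < b; 0 < \<eta>\<rbrakk> \<Longrightarrow> eventually (\<lambda>h. z (t + h) \<le> z t + \<eta> * h) (at_right 0)"
  shows "z b \<le> z a"
proof -
  have "z b - \<eta> * (b - a) \<le> z a" if "\<eta> > 0" for \<eta>
  proof (rule ccontr)
    define g where "g s = z s - \<eta> * (s - a)" for s
    assume "\<not> z b - \<eta> * (b - a) \<le> z a"
    hence gab: "g a < g b" by (simp add: g_def)
    \<comment> \<open>Since \<open>g b\<close> exceeds \<open>g a\<close>, the last point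
      \<open>T\<close> of \<open>S\<close> lies before \<open>b\<close>; the Dini hypothesis then
      carries the inequality a little beyond \<open>T\<close>.\<close>
    define S where "S = {a..b} \<inter> g -` {..g a}"
    have contg: "continuous_on {a..b} g" unfolding g_def by (intro continuous_intros cont)
    have "closed S" unfolding S_def by (intro continuous_closed_preimage contg) auto
    moreover have "bounded S" unfolding S_def by (rule bounded_subset[of "{a..b}"]) auto
    moreover have "a \<in> S" using ab by (simp add: S_def)
    ultimately obtain T where T: "T \<in> S" "\<And>s. s \<in> S \<Longrightarrow> s \<le> T"
      using compact_attains_sup[of S] by (metis compact_eq_bounded_closed empty_iff)
    have "T \<noteq> b" using T(1) gab by (auto simp: S_def)
    with T(1) have Tb: "a \<le> T" "T < b" by (auto simp: S_def)
    have "eventually (\<lambda>h. z (T + h) \<le> z T + \<eta> * h) (at_right 0)"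
      using dini Tb \<open>\<eta> > 0\<close> by blast
    moreover have "eventually (\<lambda>h. h \<in> {0<..<b - T}) (at_right (0::real))"
      using Tb by (intro eventually_at_right_real) auto
    ultimately have "eventually (\<lambda>h. z (T + h) \<le> z T + \<eta> * h \<and> h \<in> {0<..<b - T}) (at_right 0)"
      by (rule eventually_conj)
    then obtain h where h: "z (T + h) \<le> z T + \<eta> * h" "0 < h" "h < b - T"
      using eventually_happens[of _ "at_right (0::real)"] by (auto simp: trivial_limit_at_right_real)
    have "g (T + h) \<le> g T" using h by (simp add: g_def algebra_simps)
    hence "T + h \<in> S" using T(1) h Tb by (auto simp: S_def)
    with T(2)[of "T + h"] h show False by simp
  qed
  hence *: "z b \<le> z a + \<eta> * (b - a)" if "\<eta> > 0" for \<eta> using that by fastforce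
  show ?thesis
  proof (cases "a = b")
    case False
    with ab have "b - a > 0" by simp
    show ?thesis
    proof (rule field_le_epsilon)
      fix e :: real assume "e > 0"
      with *[of "e / (b - a)"] \<open>b - a > 0\<close> show "z b \<le> z a + e" by simp
    qed
  qed simp
qed

text \<open>The integrating factor exp (r t) reduces the claim to
  \<open>Dini_nonincreasing\<close>.\<close>

lemma Dini_Gronwall:
  fixes y :: "real \<Rightarrow> real"
  assumes cont: "continuous_on {0..} y" and "t \<ge> 0"
    and dini: "\<And>t \<eta>. \<lbrakk>0 < t; 0 < \<eta>\<rbrakk> \<Longrightarrow>
        eventually (\<lambda>h. y (t + h) \<le> y t + h * (\<eta> - r * y t)) (at_right 0)"
  shows "y t \<le> y 0 * exp (- r * t)"
proof -
  define z where "z s = y s * exp (r * s)" for s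
  have contz: "continuous_on {0..} z" unfolding z_def by (intro continuous_intros cont)
  have zd: "eventually (\<lambda>h. z (s + h) \<le> z s + \<eta> * h) (at_right 0)" if s: "0 < s" "0 < \<eta>" for s \<eta>
  proof -
    define \<eta>' where "\<eta>' = \<eta> / (2 * exp (r * s))"
    have \<eta>': "\<eta>' > 0" "exp (r * s) * \<eta>' = \<eta> / 2" using s by (auto simp: \<eta>'_def)
    \<comment> \<open>The upper bound for \<open>z (s + h)\<close> given by the hypothesis. Its
      right derivative at 0 is \<eta> / 2, strictly below the allowed slope \<eta>.\<close>
    define Z where "Z h = (y s + h * (\<eta>' - r * y s)) * exp (r * (s + h))" for h
    have "(Z has_real_derivative exp (r * s) * \<eta>') (at 0 within {0<..})"
      unfolding Z_def by (auto intro!: derivative_eq_intros simp: algebra_simps)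
    hence "((\<lambda>h. (Z h - Z 0) / h) \<longlongrightarrow> \<eta> / 2) (at_right 0)"
      unfolding \<eta>' has_field_derivative_iff by simp
    hence "eventually (\<lambda>h. (Z h - Z 0) / h < \<eta>) (at_right 0)"
      using s(2) by (intro order_tendstoD(2)[where y="\<eta> / 2"]) auto
    moreover have "eventually (\<lambda>h. h > (0::real)) (at_right 0)"
      by (rule eventually_at_right_less)
    ultimately show ?thesis using dini[OF s(1) \<eta>'(1)]
    proof eventually_elim
      case (elim h)
      have "z (s + h) \<le> Z h" unfolding z_def Z_def using elim by (intro mult_right_mono) auto
      also have "Z h \<le> Z 0 + \<eta> * h" using elim by (simp add: pos_divide_less_eq)
      finally show ?case by (simp add: Z_def z_def)
    qed
  qed
  \<comment> \<open>The hypothesis is silent at time 0, so the comparison starts at s > 0 and s is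
    then sent to 0 by continuity.\<close>
  have le: "z t \<le> z s" if "0 < s" "s \<le> t" for s
    by (rule Dini_nonincreasing[OF that(2) continuous_on_subset[OF contz]]) (use that zd in auto)
  have "z t \<le> z 0"
  proof (cases "t = 0")
    case False
    have "(z \<longlongrightarrow> z 0) (at 0 within {0..})"
      using contz by (auto simp: continuous_on_def)
    hence "(z \<longlongrightarrow> z 0) (at_right 0)"
      by (rule tendsto_mono[rotated]) (auto intro: at_le)
    moreover have "eventually (\<lambda>s. z t \<le> z s) (at_right 0)"
      using eventually_at_right_real[of 0 t] \<open>t \<ge> 0\<close> False
      by (auto elim!: eventually_mono intro!: le)
    ultimately show ?thesis by (rule tendsto_lowerbound) simp
  qed simp
  hence "y t * exp (r * t) * exp (- r * t) \<le> y 0 * exp (- r * t)"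
    by (intro mult_right_mono) (auto simp: z_def)
  thus ?thesis by (simp add: mult.assoc flip: exp_add)
qed

section \<open>Integrals over one period and one-periodic functions\<close>

definition pint :: "(real \<Rightarrow> real) \<Rightarrow> real" where
  "pint f = integral {-1/2..1/2} f"

lemma pint_integrable:
  "continuous_on UNIV f \<Longrightarrow> f integrable_on {-1/2..1/2::real}" for f :: "real \<Rightarrow> real"
  by (rule integrable_continuous_interval, rule continuous_on_subset) auto

lemma pint_add: "\<lbrakk>continuous_on UNIV f; continuous_on UNIV g\<rbrakk> \<Longrightarrow> pint (\<lambda>x. f x + g x) = pint f + pint g"
  unfolding pint_def by (intro integral_add pint_integrable)

lemma pint_diff: "\<lbrakk>continuous_on UNIV f; continuous_on UNIV g\<rbrakk> \<Longrightarrow> pint (\<lambda>x. f x - g x) = pint f - pint g"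
  unfolding pint_def by (intro integral_diff pint_integrable)

lemma pint_cmult: "pint (\<lambda>x. c * f x) = c * pint f"
  unfolding pint_def by simp

lemma pint_minus: "pint (\<lambda>x. - f x) = - pint f"
  unfolding pint_def by simp

lemma pint_const [simp]: "pint (\<lambda>x. c) = c"
  unfolding pint_def by (subst integral_const_real) simp

lemma pint_mono:
  "\<lbrakk>continuous_on UNIV f; continuous_on UNIV g; \<And>x. x \<in> {-1/2..1/2} \<Longrightarrow> f x \<le> g x\<rbrakk> \<Longrightarrow> pint f \<le> pint g"
  unfolding pint_def by (intro integral_le pint_integrable)

lemma pint_nonneg:
  "\<lbrakk>continuous_on UNIV f; \<And>x. x \<in> {-1/2..1/2} \<Longrightarrow> 0 \<le> f x\<rbrakk> \<Longrightarrow> 0 \<le> pint f"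
  using pint_mono[OF continuous_on_const, of f 0] by simp

lemma pint_deriv_eq_0:
  assumes "\<And>x. (f has_real_derivative f' x) (at x)" and "\<And>x. f (x + 1) = f x"
  shows "pint f' = 0"
proof -
  have "(f' has_integral f (1/2) - f (-1/2)) {-1/2..1/2}"
    by (intro fundamental_theorem_of_calculus)
       (auto intro!: has_field_derivative_at_within assms
             simp: has_real_derivative_iff_has_vector_derivative[symmetric])
  moreover have "f (1/2) = f (-1/2)" using assms(2)[of "-1/2"] by simp
  ultimately show ?thesis unfolding pint_def by (auto intro: integral_unique)
qed

lemma pint_by_parts:
  assumes f: "\<And>x. (f has_real_derivative f' x) (at x)" "\<And>x. f (x + 1) = f x"
    and g: "\<And>x. (g has_real_derivative g' x) (at x)" "\<And>x. g (x + 1) = g x"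
    and "continuous_on UNIV f'" "continuous_on UNIV g'"
  shows "pint (\<lambda>x. f x * g' x) = - pint (\<lambda>x. f' x * g x)"
proof -
  have cf: "continuous_on UNIV f" "continuous_on UNIV g"
    using f(1) g(1) by (auto intro!: DERIV_continuous_on)
  have "pint (\<lambda>x. f x * g' x + f' x * g x) = 0"
    by (rule pint_deriv_eq_0[of "\<lambda>x. f x * g x"])
       (auto intro!: derivative_eq_intros f g simp: f(2) g(2))
  thus ?thesis using cf assms(5,6) by (subst (asm) pint_add) (auto intro!: continuous_intros)
qed

lemma periodic_diff_integer:
  fixes f :: "real \<Rightarrow> 'a"
  assumes "\<And>x. f (x + 1) = f x"
  shows "f (x + of_int k) = f x"
proof (induction k rule: int_induct[where k=0])
  case (step1 i)
  show ?case using assms[of "x + of_int i"] step1 by (simp add: algebra_simps)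
next
  case (step2 i)
  show ?case using assms[of "x + of_int (i - 1)"] step2 by (simp add: algebra_simps)
qed simp

lemma periodic_reduce:
  fixes f :: "real \<Rightarrow> 'a"
  assumes "\<And>x. f (x + 1) = f x" and "\<And>x. x \<in> {-1/2..1/2} \<Longrightarrow> P (f x)"
  shows "P (f x)"
proof -
  define k where "k = \<lfloor>x + 1/2\<rfloor>"
  have "of_int k \<le> x + 1/2" "x + 1/2 < of_int k + 1"
    unfolding k_def using floor_correct[of "x + 1/2"] by (auto simp only:)
  hence "x - of_int k \<in> {-1/2..1/2}" by simp
  hence "P (f (x - of_int k))" by (rule assms(2))
  moreover have "f (x - of_int k) = f x"
    using periodic_diff_integer[of f x "- k", OF assms(1)] by simp
  ultimately show ?thesis by simp
qed

lemma pint_eq_0_zero: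
  assumes "continuous_on UNIV f" "pint f = 0"
  obtains x where "x \<in> {-1/2..1/2}" "f x = 0"
proof -
  have cI: "continuous_on {-1/2..1/2} f" using assms(1) continuous_on_subset by blast
  obtain a where a: "a \<in> {-1/2..1/2}" "\<And>x. x \<in> {-1/2..1/2} \<Longrightarrow> f a \<le> f x"
    using continuous_attains_inf[OF _ _ cI] by auto
  obtain b where b: "b \<in> {-1/2..1/2}" "\<And>x. x \<in> {-1/2..1/2} \<Longrightarrow> f x \<le> f b"
    using continuous_attains_sup[OF _ _ cI] by auto
  have "f a \<le> 0" using pint_mono[of "\<lambda>x. f a" f] assms a by simp
  moreover have "0 \<le> f b" using pint_mono[of f "\<lambda>x. f b"] assms b by simp
  moreover have "connected (f ` {-1/2..1/2})"
    by (intro connected_continuous_image cI) simp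
  ultimately have "0 \<in> f ` {-1/2..1/2}"
    using connectedD_interval[of "f ` {-1/2..1/2}" "f a" "f b" 0] a(1) b(1) by blast
  thus ?thesis using that by auto
qed

lemma diff_le_pint_abs:
  assumes f: "\<And>x. (f has_real_derivative f' x) (at x)" and c: "continuous_on UNIV f'"
    and xy: "x \<in> {-1/2..1/2}" "y \<in> {-1/2..1/2}"
  shows "\<bar>f x - f y\<bar> \<le> pint (\<lambda>x. \<bar>f' x\<bar>)"
proof -
  have *: "\<bar>f b - f a\<bar> \<le> pint (\<lambda>x. \<bar>f' x\<bar>)" if "a \<le> b" "a \<in> {-1/2..1/2}" "b \<in> {-1/2..1/2}" for a b
  proof -
    have "(f' has_integral f b - f a) {a..b}"
      using that by (intro fundamental_theorem_of_calculus)
       (auto intro!: has_field_derivative_at_within f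
             simp: has_real_derivative_iff_has_vector_derivative[symmetric])
    hence "\<bar>f b - f a\<bar> = norm (integral {a..b} f')" by (simp add: integral_unique)
    also have "\<dots> \<le> integral {a..b} (\<lambda>x. \<bar>f' x\<bar>)"
      by (intro integral_norm_bound_integral integrable_continuous_interval continuous_intros
            continuous_on_subset[OF c]) auto
    also have "\<dots> \<le> integral {-1/2..1/2} (\<lambda>x. \<bar>f' x\<bar>)"
      using that by (intro integral_subset_le integrable_continuous_interval continuous_intros
            continuous_on_subset[OF c]) auto
    finally show ?thesis by (simp add: pint_def)
  qed
  show ?thesis using *[of x y] *[of y x] xy by (cases "x \<le> y") (auto simp: abs_minus_commute)
qed

text \<open>The variance of \<bar>f\<bar> over a period of length one is nonnegative.\<close>

lemma pint_abs_power2_le: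
  assumes "continuous_on UNIV f"
  shows "(pint (\<lambda>x. \<bar>f x\<bar>))\<^sup>2 \<le> pint (\<lambda>x. (f x)\<^sup>2)"
proof -
  define c where "c = pint (\<lambda>x. \<bar>f x\<bar>)"
  have "0 \<le> pint (\<lambda>x. (\<bar>f x\<bar> - c)\<^sup>2)" by (intro pint_nonneg continuous_intros assms) auto
  also have "(\<lambda>x. (\<bar>f x\<bar> - c)\<^sup>2) = (\<lambda>x. (f x)\<^sup>2 + (c\<^sup>2 - 2 * c * \<bar>f x\<bar>))"
    by (auto simp: power2_eq_square algebra_simps)
  also have "pint \<dots> = pint (\<lambda>x. (f x)\<^sup>2) + (c\<^sup>2 - 2 * c * c)"
    by (subst pint_add, (intro continuous_intros assms)+, subst pint_diff)
       (auto intro!: continuous_intros assms simp: pint_cmult c_def)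
  finally show ?thesis by (simp add: c_def power2_eq_square)
qed

text \<open>A Poincare inequality in the sup norm: the zero of \<open>f\<close> fixes the constant
  of integration, and Cauchy-Schwarz on a period of length one costs no factor.\<close>

lemma power2_le_pint_deriv:
  assumes f: "\<And>x. (f has_real_derivative f' x) (at x)" and c: "continuous_on UNIV f'"
    and "f y = 0" "x \<in> {-1/2..1/2}" "y \<in> {-1/2..1/2}"
  shows "(f x)\<^sup>2 \<le> pint (\<lambda>x. (f' x)\<^sup>2)"
proof -
  have "\<bar>f x\<bar> \<le> pint (\<lambda>x. \<bar>f' x\<bar>)" using diff_le_pint_abs[OF f c assms(4,5)] assms(3) by simp
  hence "\<bar>f x\<bar>\<^sup>2 \<le> (pint (\<lambda>x. \<bar>f' x\<bar>))\<^sup>2" by (intro power_mono) auto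
  also have "\<dots> \<le> pint (\<lambda>x. (f' x)\<^sup>2)" by (rule pint_abs_power2_le[OF c])
  finally show ?thesis by simp
qed

section \<open>Damped oscillators, level curves and parameter integrals\<close>

text \<open>The equation is p'' + \<nu> p' + p = - g. Quantifying over \<open>p\<close>,
  \<open>v\<close> and \<open>g\<close> inside makes \<open>C\<close> and \<open>r\<close> serve all
  pairs of characteristics of all solutions at once.\<close>

definition oscillator_bound :: "real \<Rightarrow> real \<Rightarrow> real \<Rightarrow> real \<Rightarrow> real \<Rightarrow> real \<Rightarrow> bool" where
  "oscillator_bound \<nu> a B A C r \<longleftrightarrow> (\<forall>p v g.
    continuous_on {0..} p \<and> continuous_on {0..} v \<and>
    (\<forall>t>0. (p has_real_derivative v t) (at t)) \<and>
    (\<forall>t>0. (v has_real_derivative - \<nu> * v t - p t - g t) (at t)) \<and>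
    (\<forall>t\<ge>0. \<bar>g t\<bar> \<le> B * exp (- a * t)) \<and> \<bar>p 0\<bar> \<le> A \<and> \<bar>v 0\<bar> \<le> A \<longrightarrow>
    (\<forall>t\<ge>0. \<bar>p t\<bar> \<le> C * exp (- r * t) \<and> \<bar>v t\<bar> \<le> C * exp (- r * t)))"

text \<open>Friction dissipates only \<open>v\<close>. Adding \<epsilon> p v to the mechanical
  energy puts - \<epsilon> p^2 into the derivative and so restores the missing coordinate.\<close>

lemma damped_oscillator_decay:
  fixes \<nu> a B A :: real
  assumes \<nu>: "\<nu> > 0" and a: "a > 0"
  shows "\<exists>C>0. \<exists>r>0. oscillator_bound \<nu> a B A C r"
proof -
  \<comment> \<open>The bound 1/2 keeps \<open>L\<close> comparable with v^2 + p^2; the other one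
    gives \<epsilon> (1 + \<nu>^2) \<le> \<nu>/4, so the terms in v^2 created by the cross term are
    absorbed by the friction.\<close>
  define \<epsilon> where "\<epsilon> = min (1/2) (\<nu> / (4 * (1 + \<nu>\<^sup>2)))"
  have pos: "1 + \<nu>\<^sup>2 > 0" by (simp add: add_pos_nonneg)
  have \<epsilon>0: "\<epsilon> > 0" using \<nu> pos by (simp add: \<epsilon>_def)
  have \<epsilon>1: "\<epsilon> \<le> 1/2" unfolding \<epsilon>_def by (rule min.cobounded1)
  have "\<epsilon> * (1 + \<nu>\<^sup>2) \<le> \<nu> / (4 * (1 + \<nu>\<^sup>2)) * (1 + \<nu>\<^sup>2)"
    using pos by (intro mult_right_mono) (auto simp: \<epsilon>_def)
  also have "\<dots> = \<nu> / 4" using pos by (simp add: field_simps)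
  finally have \<epsilon>2: "\<epsilon> + \<epsilon> * \<nu>\<^sup>2 \<le> \<nu> / 4" by (simp add: algebra_simps)
  have "0 \<le> \<epsilon> * \<nu>\<^sup>2" using \<epsilon>0 by simp
  with \<epsilon>2 have \<epsilon>3: "\<epsilon> \<le> \<nu> / 4" by linarith
  \<comment> \<open>With s \<le> a the squared forcing, of rate 2a, decays strictly faster than exp
    (- s t), which excludes resonance.\<close>
  define s where "s = min (\<epsilon> / 2) a"
  have s: "0 < s" "s \<le> \<epsilon> / 2" "s < 2 * a" using \<epsilon>0 a by (auto simp: s_def)
  define D where "D = (1 / \<nu> + \<epsilon>) * B\<^sup>2"
  have D: "D \<ge> 0" using \<nu> \<epsilon>0 by (simp add: D_def)
  \<comment> \<open>2 A^2 bounds the initial value of \<open>L\<close>, and D / (2a - s) is the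
    total contribution of the forcing.\<close>
  define N where "N = 2 * A\<^sup>2 + D / (2 * a - s)"
  have N: "N \<ge> 0" using D s by (auto simp: N_def)
  define C where "C = 4 * N + 1"
  have C: "C > 0" using N by (simp add: C_def)
  have C2: "4 * N \<le> C\<^sup>2" using N by (simp add: C_def power2_eq_square algebra_simps)
  have main: "\<bar>p t\<bar> \<le> C * exp (- (s / 2) * t) \<and> \<bar>v t\<bar> \<le> C * exp (- (s / 2) * t)"
    if cont: "continuous_on {0..} p" "continuous_on {0..} v"
      and dp: "\<And>t. t > 0 \<Longrightarrow> (p has_real_derivative v t) (at t)"
      and dv: "\<And>t. t > 0 \<Longrightarrow> (v has_real_derivative - \<nu> * v t - p t - g t) (at t)"
      and g: "\<And>t. t \<ge> 0 \<Longrightarrow> \<bar>g t\<bar> \<le> B * exp (- a * t)"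
      and ini: "\<bar>p 0\<bar> \<le> A" "\<bar>v 0\<bar> \<le> A" and t: "t \<ge> 0"
    for p v g :: "real \<Rightarrow> real" and t
  proof -
    define L where "L t = (v t)\<^sup>2 / 2 + (p t)\<^sup>2 / 2 + \<epsilon> * (p t * v t)" for t
    have pv: "\<bar>\<epsilon> * (p t * v t)\<bar> \<le> (v t)\<^sup>2 / 4 + (p t)\<^sup>2 / 4" for t
    proof -
      have "\<bar>p t * v t\<bar> \<le> (v t)\<^sup>2 / 2 + (p t)\<^sup>2 / 2"
        using sum_squares_ge_zero[of "\<bar>p t\<bar> - \<bar>v t\<bar>" 0]
        by (simp add: power2_eq_square algebra_simps abs_mult)
      hence "\<epsilon> * \<bar>p t * v t\<bar> \<le> 1 / 2 * ((v t)\<^sup>2 / 2 + (p t)\<^sup>2 / 2)"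
        using \<epsilon>0 \<epsilon>1 by (intro mult_mono) auto
      thus ?thesis using \<epsilon>0 by (simp add: abs_mult)
    qed
    have quad: "V + P \<le> 4 * (V / 2 + P / 2 + w) \<and> V / 2 + P / 2 + w \<le> V + P"
      if "\<bar>w\<bar> \<le> V / 4 + P / 4" "0 \<le> V" "0 \<le> P" for V P w :: real
      using that by argo
    have Llow: "(v t)\<^sup>2 + (p t)\<^sup>2 \<le> 4 * L t" and Lup: "L t \<le> (v t)\<^sup>2 + (p t)\<^sup>2" for t
      using quad[OF pv[of t]] unfolding L_def by simp_all
    define L' where "L' t = v t * (- \<nu> * v t - p t - g t) + p t * v t
        + \<epsilon> * (p t * (- \<nu> * v t - p t - g t) + v t * v t)" for t
    have dL: "(L has_real_derivative L' t) (at t)" if "t > 0" for t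
      unfolding L_def L'_def
      by (auto intro!: derivative_eq_intros dp[OF that] dv[OF that] simp: field_simps)
    have L': "L' t \<le> - s * L t + D * exp (- (2 * a) * t)" if "t > 0" for t
    proof -
      have "(g t)\<^sup>2 \<le> (B * exp (- a * t))\<^sup>2"
        using g[of t] that by (metis abs_ge_zero less_imp_le power2_abs power_mono)
      also have "\<dots> = B\<^sup>2 * exp (- (2 * a) * t)"
        by (simp add: power_mult_distrib flip: exp_double)
      finally have g2: "(1 / \<nu> + \<epsilon>) * (g t)\<^sup>2 \<le> D * exp (- (2 * a) * t)"
        using \<nu> \<epsilon>0 unfolding D_def mult.assoc by (intro mult_left_mono) auto
      \<comment> \<open>The weights cost the friction one quarter here and another quarter through
        \<epsilon> (1 + \<nu>^2), and cost \<epsilon> p^2 one half.\<close>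
      have 1: "- (v t * g t) \<le> \<nu> / 4 * (v t)\<^sup>2 + 1 / \<nu> * (g t)\<^sup>2"
      proof -
        have "0 \<le> 1 / \<nu> * (\<nu> / 2 * v t + g t)\<^sup>2" using \<nu> by simp
        also have "\<dots> = \<nu> / 4 * (v t)\<^sup>2 + 1 / \<nu> * (g t)\<^sup>2 + v t * g t"
          using \<nu> by (simp add: power2_eq_square field_simps)
        finally show ?thesis by simp
      qed
      have 2: "- (\<nu> * (p t * v t)) \<le> 1 / 4 * (p t)\<^sup>2 + \<nu>\<^sup>2 * (v t)\<^sup>2"
        using zero_le_power2[of "p t / 2 + \<nu> * v t"]
        by (simp add: power2_eq_square algebra_simps)
      have 3: "- (p t * g t) \<le> 1 / 4 * (p t)\<^sup>2 + (g t)\<^sup>2"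
        using zero_le_power2[of "p t / 2 + g t"] by (simp add: power2_eq_square algebra_simps)
      have "L' t = - \<nu> * (v t)\<^sup>2 + \<epsilon> * (v t)\<^sup>2 - \<epsilon> * (p t)\<^sup>2 + (- (v t * g t))
          + \<epsilon> * (- (\<nu> * (p t * v t))) + \<epsilon> * (- (p t * g t))"
        unfolding L'_def by (simp add: power2_eq_square algebra_simps)
      also have "\<dots> \<le> - \<nu> * (v t)\<^sup>2 + \<epsilon> * (v t)\<^sup>2 - \<epsilon> * (p t)\<^sup>2
          + (\<nu> / 4 * (v t)\<^sup>2 + 1 / \<nu> * (g t)\<^sup>2)
          + \<epsilon> * (1 / 4 * (p t)\<^sup>2 + \<nu>\<^sup>2 * (v t)\<^sup>2) + \<epsilon> * (1 / 4 * (p t)\<^sup>2 + (g t)\<^sup>2)"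
        using 1 mult_left_mono[OF 2, of \<epsilon>] mult_left_mono[OF 3, of \<epsilon>] \<epsilon>0 by linarith
      also have "\<dots> = (\<epsilon> + \<epsilon> * \<nu>\<^sup>2) * (v t)\<^sup>2 - 3 / 4 * \<nu> * (v t)\<^sup>2 - \<epsilon> / 2 * (p t)\<^sup>2
          + (1 / \<nu> + \<epsilon>) * (g t)\<^sup>2"
        by (simp add: algebra_simps)
      also have "\<dots> \<le> \<nu> / 4 * (v t)\<^sup>2 - 3 / 4 * \<nu> * (v t)\<^sup>2 - \<epsilon> / 2 * (p t)\<^sup>2
          + (1 / \<nu> + \<epsilon>) * (g t)\<^sup>2"
        using mult_right_mono[OF \<epsilon>2, of "(v t)\<^sup>2"] by simp
      also have "\<dots> \<le> - (\<epsilon> / 2) * ((v t)\<^sup>2 + (p t)\<^sup>2) + (1 / \<nu> + \<epsilon>) * (g t)\<^sup>2"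
      proof -
        have "\<epsilon> / 2 * (v t)\<^sup>2 \<le> \<nu> / 2 * (v t)\<^sup>2"
          using \<epsilon>3 \<nu> by (intro mult_right_mono) auto
        thus ?thesis by (simp add: algebra_simps)
      qed
      also have "\<dots> \<le> - s * L t + D * exp (- (2 * a) * t)"
      proof -
        have "0 \<le> L t" using Llow[of t] zero_le_power2[of "v t"] zero_le_power2[of "p t"] by linarith
        hence "s * L t \<le> \<epsilon> / 2 * ((v t)\<^sup>2 + (p t)\<^sup>2)"
          using s Lup by (intro mult_mono) auto
        thus ?thesis using g2 by simp
      qed
      finally show ?thesis .
    qed
    define c where "c = 2 * a - s"
    define \<kappa> where "\<kappa> = D / c"
    have c: "c > 0" "\<kappa> * c = D" "\<kappa> \<ge> 0" using s D by (auto simp: c_def \<kappa>_def)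
    \<comment> \<open>The derivative of the second summand cancels the forcing that remains after
      multiplication by exp (s t), so \<open>H\<close> decreases.\<close>
    define H where "H t = L t * exp (s * t) + \<kappa> * exp (- c * t)" for t
    have "H t \<le> H 0"
    proof (rule DERIV_nonpos_imp_decreasing_open[OF t])
      show "continuous_on {0..t} H" unfolding H_def L_def
        by (intro continuous_intros continuous_on_subset[OF cont(1)] continuous_on_subset[OF cont(2)]) auto
      fix x :: real assume x: "0 < x"
      have "(H has_real_derivative L' x * exp (s * x) + L x * (s * exp (s * x))
          + \<kappa> * (- c * exp (- c * x))) (at x)"
        unfolding H_def by (auto intro!: derivative_eq_intros dL x simp: algebra_simps)
      moreover have "L' x * exp (s * x) + L x * (s * exp (s * x))
          + \<kappa> * (- c * exp (- c * x)) \<le> 0"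
      proof -
        have e: "exp (- c * x) = exp (- (2 * a) * x) * exp (s * x)"
          by (simp add: algebra_simps c_def flip: exp_add)
        have "\<kappa> * (- c * exp (- c * x)) = - (D * exp (- (2 * a) * x)) * exp (s * x)"
          unfolding e by (simp add: c(2)[symmetric])
        moreover have "L' x * exp (s * x) \<le> (- s * L x + D * exp (- (2 * a) * x)) * exp (s * x)"
          using L'[OF x] by (intro mult_right_mono) auto
        ultimately show ?thesis by (simp add: algebra_simps)
      qed
      ultimately show "\<exists>y. (H has_real_derivative y) (at x) \<and> y \<le> 0" by blast
    qed
    also have "H 0 \<le> N"
    proof -
      have "(p 0)\<^sup>2 \<le> A\<^sup>2" "(v 0)\<^sup>2 \<le> A\<^sup>2"
        using ini by (metis abs_ge_zero power2_abs power_mono)+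
      with Lup[of 0] show ?thesis by (simp add: H_def N_def \<kappa>_def c_def)
    qed
    finally have "L t * exp (s * t) + \<kappa> * exp (- c * t) \<le> N" by (simp add: H_def)
    moreover have "0 \<le> \<kappa> * exp (- c * t)" using c by simp
    ultimately have "L t * exp (s * t) \<le> N" by linarith
    hence "L t * exp (s * t) * exp (- s * t) \<le> N * exp (- s * t)" by (intro mult_right_mono) auto
    hence Lt: "L t \<le> N * exp (- s * t)" by (simp add: mult.assoc flip: exp_add)
    have "4 * N * exp (- s * t) \<le> C\<^sup>2 * exp (- s * t)" using C2 by (intro mult_right_mono) auto
    also have "\<dots> = (C * exp (- (s / 2) * t))\<^sup>2"
      by (simp add: power_mult_distrib flip: exp_double)
    finally have b: "4 * N * exp (- s * t) \<le> (C * exp (- (s / 2) * t))\<^sup>2" .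
    have "(p t)\<^sup>2 \<le> (C * exp (- (s / 2) * t))\<^sup>2"
      using Llow[of t] Lt b zero_le_power2[of "v t"] by linarith
    moreover have "(v t)\<^sup>2 \<le> (C * exp (- (s / 2) * t))\<^sup>2"
      using Llow[of t] Lt b zero_le_power2[of "p t"] by linarith
    ultimately show ?thesis using C by (simp flip: abs_le_square_iff)
  qed
  show ?thesis unfolding oscillator_bound_def
    by (rule exI[of _ C], rule conjI[OF C], rule exI[of _ "s / 2"], rule conjI)
       (use s in simp, use main in blast)
qed

section \<open>Antiderivatives and integrals depending on a parameter\<close>

definition antideriv :: "(real \<Rightarrow> real) \<Rightarrow> real \<Rightarrow> real" where
  "antideriv f x = integral {0..x} f - integral {x..0} f"

lemma antideriv_0 [simp]: "antideriv f 0 = 0"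
  by (simp add: antideriv_def)

text \<open>One of the two integrals in \<open>antideriv\<close> is over an empty or one-point
  interval, so it is the signed integral from 0. Near \<open>x\<close> it differs by a constant from
  an integral with the fixed base point -N, to which the fundamental theorem applies.\<close>

lemma antideriv_derivative:
  assumes "continuous_on UNIV f"
  shows "(antideriv f has_real_derivative f x) (at x)"
proof -
  define N where "N = \<bar>x\<bar> + 1"
  have c: "continuous_on S f" for S using assms continuous_on_subset by blast
  have eq: "antideriv f y = integral {-N..y} f - integral {-N..0} f" if "y \<in> {-N..N}" for y
  proof (cases "y \<ge> 0")
    case True
    have "integral {-N..0} f + integral {0..y} f = integral {-N..y} f"
      using True by (intro Henstock_Kurzweil_Integration.integral_combine integrable_continuous_interval c)
        (auto simp: N_def)
    thus ?thesis using True by (cases "y = 0") (auto simp: antideriv_def)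
  next
    case False
    have "integral {-N..y} f + integral {y..0} f = integral {-N..0} f"
      using False that by (intro Henstock_Kurzweil_Integration.integral_combine integrable_continuous_interval c)
        auto
    thus ?thesis using False by (auto simp: antideriv_def)
  qed
  have x: "x \<in> interior {-N..N}" by (auto simp: N_def)
  have "((\<lambda>y. integral {-N..y} f - integral {-N..0} f) has_real_derivative f x) (at x within {-N..N})"
    using x by (auto intro!: derivative_eq_intros integral_has_real_derivative c simp: interior_subset[THEN subsetD])
  hence "((\<lambda>y. integral {-N..y} f - integral {-N..0} f) has_real_derivative f x) (at x)"
    using at_within_interior[OF x] by simp
  moreover have "eventually (\<lambda>y. y \<in> interior {-N..N}) (nhds x)"
    using x by (intro eventually_nhds_in_open) auto
  hence "eventually (\<lambda>y. antideriv f y = integral {-N..y} f - integral {-N..0} f) (nhds x)"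
    by eventually_elim (use interior_subset eq in blast)
  ultimately show ?thesis by (subst DERIV_cong_ev[OF refl _ refl])
qed

lemma antideriv_eq:
  assumes "continuous_on UNIV f" "\<And>x. (G has_real_derivative f x) (at x)"
  shows "antideriv f x = G x - G 0"
proof -
  have "((\<lambda>x. antideriv f x - G x) has_real_derivative 0) (at x)" for x
    by (auto intro!: derivative_eq_intros antideriv_derivative assms)
  from DERIV_isconst_all[of "\<lambda>x. antideriv f x - G x", rule_format, OF this, of x 0]
  show ?thesis by simp
qed

lemma continuous_on_slice:
  assumes "continuous_on (S \<times> UNIV) (\<lambda>(t, x). f t x)" "t \<in> S"
  shows "continuous_on UNIV (f t)"
proof -
  have "continuous_on UNIV (\<lambda>x. (\<lambda>(t, x). f t x) (t, x))"
    by (rule continuous_on_compose2[OF assms(1)]) (use assms(2) in \<open>auto intro!: continuous_intros\<close>)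
  thus ?thesis by simp
qed

lemma leibniz_interval:
  fixes f ft :: "real \<Rightarrow> real \<Rightarrow> real"
  assumes S: "open S" "convex S" "t \<in> S"
    and f: "\<And>s x. s \<in> S \<Longrightarrow> ((\<lambda>s. f s x) has_real_derivative ft s x) (at s)"
    and c: "continuous_on (S \<times> UNIV) (\<lambda>(t, x). ft t x)"
    and cf: "\<And>s. s \<in> S \<Longrightarrow> continuous_on UNIV (f s)"
  shows "((\<lambda>s. integral {a..b} (f s)) has_real_derivative integral {a..b} (ft t)) (at t)"
proof -
  have "((\<lambda>s. integral (cbox a b) (f s)) has_real_derivative integral (cbox a b) (ft t)) (at t within S)"
  proof (rule leibniz_rule_field_derivative)
    show "continuous_on (S \<times> cbox a b) (\<lambda>(x, t). ft x t)"
      by (rule continuous_on_subset[OF c]) auto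
    show "f s integrable_on cbox a b" if "s \<in> S" for s
      by (intro integrable_continuous continuous_on_subset[OF cf[OF that]]) auto
  qed (use f S in \<open>auto intro: has_field_derivative_at_within\<close>)
  thus ?thesis using at_within_open[OF S(3,1)] by simp
qed

lemmas leibniz_pint = leibniz_interval[of _ _ _ _ "-1/2" "1/2", folded pint_def]

lemma leibniz_antideriv:
  assumes "open S" "convex S" "t \<in> S"
    and "\<And>s x. s \<in> S \<Longrightarrow> ((\<lambda>s. f s x) has_real_derivative ft s x) (at s)"
    and "continuous_on (S \<times> UNIV) (\<lambda>(t, x). ft t x)"
    and "\<And>s. s \<in> S \<Longrightarrow> continuous_on UNIV (f s)"
  shows "((\<lambda>s. antideriv (f s) x) has_real_derivative antideriv (ft t) x) (at t)"
  unfolding antideriv_def by (intro derivative_intros leibniz_interval[OF assms])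

lemma continuous_on_integral_param:
  fixes f :: "real \<Rightarrow> real \<Rightarrow> real"
  assumes "continuous_on (S \<times> UNIV) (\<lambda>(t, x). f t x)"
  shows "continuous_on S (\<lambda>t. integral {a..b} (f t))"
  unfolding cbox_interval[symmetric]
  by (rule integral_continuous_on_param) (rule continuous_on_subset[OF assms], auto)

section \<open>Differentiation along moving points and level curves\<close>

lemma moving_point_slope:
  fixes f fx :: "real \<Rightarrow> real \<Rightarrow> real"
  assumes S: "open S" "t \<in> S"
    and f: "\<And>s x. s \<in> S \<Longrightarrow> (f s has_real_derivative fx s x) (at x)"
    and c: "continuous_on (S \<times> UNIV) (\<lambda>(t, x). fx t x)"
    and X: "isCont X t"
  obtains k where "(k \<longlongrightarrow> fx t (X t)) (at t)"
    "\<And>s. s \<in> S \<Longrightarrow> f s (X s) - f s (X t) = k s * (X s - X t)"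
proof -
  \<comment> \<open>The slope k is \<open>fx\<close> at a mean value point between X s and X t; this
    point is squeezed to X t, and joint continuity of \<open>fx\<close> gives the limit.\<close>
  have "\<exists>z. \<bar>z - X t\<bar> \<le> \<bar>X s - X t\<bar> \<and> f s (X s) - f s (X t) = fx s z * (X s - X t)" if s: "s \<in> S" for s
  proof (cases "X s" "X t" rule: linorder_cases)
    case less
    from MVT2[OF less, of "f s" "fx s"] f[OF s] obtain z where
      "X s < z" "z < X t" "f s (X t) - f s (X s) = (X t - X s) * fx s z" by blast
    thus ?thesis by (intro exI[of _ z]) (auto simp: algebra_simps)
  next
    case greater
    from MVT2[OF greater, of "f s" "fx s"] f[OF s] obtain z where
      "X t < z" "z < X s" "f s (X s) - f s (X t) = (X s - X t) * fx s z" by blast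
    thus ?thesis by (intro exI[of _ z]) (auto simp: algebra_simps)
  qed auto
  then obtain \<xi> where \<xi>: "\<And>s. s \<in> S \<Longrightarrow> \<bar>\<xi> s - X t\<bar> \<le> \<bar>X s - X t\<bar>"
    "\<And>s. s \<in> S \<Longrightarrow> f s (X s) - f s (X t) = fx s (\<xi> s) * (X s - X t)" by metis
  have ev: "eventually (\<lambda>s. s \<in> S) (at t)"
    using S by (simp add: eventually_at_in_open')
  have "((\<lambda>s. \<bar>X s - X t\<bar>) \<longlongrightarrow> \<bar>X t - X t\<bar>) (at t)"
    using X unfolding isCont_def by (intro tendsto_intros)
  hence lim0: "((\<lambda>s. \<bar>X s - X t\<bar>) \<longlongrightarrow> 0) (at t)" by simp
  have "eventually (\<lambda>s. norm (\<xi> s - X t) \<le> \<bar>X s - X t\<bar>) (at t)"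
    using ev by (rule eventually_mono) (simp add: \<xi>(1))
  from Lim_null_comparison[OF this lim0] have "((\<lambda>s. \<xi> s - X t) \<longlongrightarrow> 0) (at t)" .
  hence \<xi>t: "(\<xi> \<longlongrightarrow> X t) (at t)" by (simp add: LIM_zero_iff)
  have "isCont (\<lambda>(t, x). fx t x) (t, X t)"
    using c S by (auto simp: continuous_on_eq_continuous_at open_Times)
  moreover have "((\<lambda>s. (s, \<xi> s)) \<longlongrightarrow> (t, X t)) (at t)" by (intro tendsto_intros \<xi>t)
  ultimately have "((\<lambda>s. (\<lambda>(t, x). fx t x) (s, \<xi> s)) \<longlongrightarrow> (\<lambda>(t, x). fx t x) (t, X t)) (at t)"
    by (rule isCont_tendsto_compose)
  hence "((\<lambda>s. fx s (\<xi> s)) \<longlongrightarrow> fx t (X t)) (at t)" by simp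
  with \<xi>(2) show ?thesis by (intro that[of "\<lambda>s. fx s (\<xi> s)"])
qed

text \<open>The increment splits into motion in time at the fixed point X t and motion in space at
  the fixed time s; the second is handled by \<open>moving_point_slope\<close>.\<close>

lemma moving_point_derivative:
  fixes f fx :: "real \<Rightarrow> real \<Rightarrow> real"
  assumes S: "open S" "t \<in> S"
    and f: "\<And>s x. s \<in> S \<Longrightarrow> (f s has_real_derivative fx s x) (at x)"
    and c: "continuous_on (S \<times> UNIV) (\<lambda>(t, x). fx t x)"
    and ft: "((\<lambda>s. f s (X t)) has_real_derivative ft) (at t)"
    and X: "(X has_real_derivative X') (at t)"
  shows "((\<lambda>s. f s (X s)) has_real_derivative ft + fx t (X t) * X') (at t)"
proof -
  obtain k where k: "(k \<longlongrightarrow> fx t (X t)) (at t)"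
    "\<And>s. s \<in> S \<Longrightarrow> f s (X s) - f s (X t) = k s * (X s - X t)"
    using moving_point_slope[OF S f c DERIV_isCont[OF X]] by blast
  have ev: "eventually (\<lambda>s. s \<in> S) (at t)"
    using S by (simp add: eventually_at_in_open')
  have "((\<lambda>s. (f s (X t) - f t (X t)) / (s - t) + k s * ((X s - X t) / (s - t)))
      \<longlongrightarrow> ft + fx t (X t) * X') (at t)"
    using ft X k(1) unfolding has_field_derivative_iff by (intro tendsto_intros)
  moreover have "eventually (\<lambda>s. (f s (X t) - f t (X t)) / (s - t) + k s * ((X s - X t) / (s - t))
      = (f s (X s) - f t (X t)) / (s - t)) (at t)"
    using ev by eventually_elim (simp add: k(2)[symmetric] flip: add_divide_distrib)
  ultimately show ?thesis unfolding has_field_derivative_iff by (rule Lim_transform_eventually)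
qed

text \<open>Implicit differentiation for a curve known only to be continuous: the level condition is
  solved for the difference quotient of \<open>X\<close>, which is possible because the slope tends
  to a nonzero limit.\<close>

lemma level_curve_derivative:
  fixes f fx :: "real \<Rightarrow> real \<Rightarrow> real"
  assumes S: "open S" "t \<in> S"
    and f: "\<And>s x. s \<in> S \<Longrightarrow> (f s has_real_derivative fx s x) (at x)"
    and c: "continuous_on (S \<times> UNIV) (\<lambda>(t, x). fx t x)"
    and ft: "((\<lambda>s. f s (X t)) has_real_derivative ft) (at t)"
    and X: "isCont X t" and lev: "\<And>s. s \<in> S \<Longrightarrow> f s (X s) = m"
    and nz: "fx t (X t) \<noteq> 0"
  shows "(X has_real_derivative - ft / fx t (X t)) (at t)"
proof -
  obtain k where k: "(k \<longlongrightarrow> fx t (X t)) (at t)"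
    "\<And>s. s \<in> S \<Longrightarrow> f s (X s) - f s (X t) = k s * (X s - X t)"
    using moving_point_slope[OF S f c X] by blast
  have ev: "eventually (\<lambda>s. s \<in> S) (at t)"
    using S by (simp add: eventually_at_in_open')
  have ev': "eventually (\<lambda>s. k s \<noteq> 0) (at t)"
    using k(1) nz tendsto_imp_eventually_ne by blast
  have "((\<lambda>s. - ((f s (X t) - f t (X t)) / (s - t)) / k s) \<longlongrightarrow> - ft / fx t (X t)) (at t)"
    using ft k(1) nz unfolding has_field_derivative_iff by (intro tendsto_intros)
  moreover have "eventually (\<lambda>s. - ((f s (X t) - f t (X t)) / (s - t)) / k s
      = (X s - X t) / (s - t)) (at t)"
    using ev ev'
  proof eventually_elim
    case (elim s)
    have "f s (X t) - f t (X t) = - (k s * (X s - X t))"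
      using k(2)[OF elim(1)] lev[OF elim(1)] lev[OF S(2)] by simp
    thus ?case using elim(2) by simp
  qed
  ultimately show ?thesis unfolding has_field_derivative_iff by (rule Lim_transform_eventually)
qed

section \<open>The solution at a fixed time and the stream function\<close>

text \<open>The half-open torus lacks only the null set {1/2}; the closed period suits compactness
  and the fundamental theorem.\<close>

lemma LBINT_torus:
  assumes "continuous_on UNIV f"
  shows "(LBINT x:torus. f x) = pint f"
proof -
  have "set_integrable lborel {-1/2..1/2} f"
    by (intro borel_integrable_atLeastAtMost' continuous_on_subset[OF assms]) auto
  hence "set_integrable lborel torus f"
    by (rule set_integrable_subset) (auto simp: torus_def)
  hence "(LBINT x:torus. f x) = integral torus f"
    by (rule set_borel_integral_eq_integral)
  also have "\<dots> = integral {-1/2..1/2} f"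
  proof (rule integral_spike_set)
    show "negligible {x \<in> torus - {-1/2..1/2}. f x \<noteq> 0}"
      by (rule negligible_subset[of "{}"]) (auto simp: torus_def)
    show "negligible {x \<in> {-1/2..1/2} - torus. f x \<noteq> 0}"
      by (rule negligible_subset[of "{1/2}"]) (auto simp: torus_def)
  qed
  finally show ?thesis by (simp add: pint_def)
qed

lemma periodic_derivative:
  assumes f: "\<And>x. (f has_real_derivative f' x) (at x)" and p: "\<And>x. f (x + 1) = f x"
  shows "f' (x + 1) = f' x"
proof -
  have "((\<lambda>y. f (y + 1)) has_real_derivative f' (x + 1)) (at x)"
    using f[of "x + 1"] by (simp add: DERIV_shift)
  moreover have "(\<lambda>y. f (y + 1)) = f" using p by auto
  ultimately show ?thesis using f[of x] DERIV_unique by metis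
qed

lemma exp_remainder_le:
  fixes x b :: real
  assumes "\<bar>x\<bar> \<le> b"
  shows "0 \<le> exp x - 1 - x" "exp x - 1 - x \<le> exp b / 2 * x\<^sup>2"
proof -
  obtain z where z: "\<bar>z\<bar> \<le> \<bar>x\<bar>" "exp x = (\<Sum>m<2. x ^ m / fact m) + exp z / fact 2 * x ^ 2"
    using Maclaurin_exp_le[of x 2] by blast
  have eq: "exp x - 1 - x = exp z / 2 * x\<^sup>2"
    using z(2) by (simp add: numeral_2_eq_2)
  show "0 \<le> exp x - 1 - x" unfolding eq by simp
  have "exp z \<le> exp b" using z(1) assms by simp
  thus "exp x - 1 - x \<le> exp b / 2 * x\<^sup>2"
    unfolding eq by (intro mult_right_mono divide_right_mono) auto
qed

locale euler_poisson =
  fixes \<nu> \<rho>\<^sub>m \<rho>\<^sub>p :: real and \<rho> u \<phi> :: "real \<Rightarrow> real \<Rightarrow> real"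
  assumes nu_pos: "\<nu> > 0" and rhom_pos: "\<rho>\<^sub>m > 0" and rhop_pos: "\<rho>\<^sub>p > 0"
    and sol: "classical_solution \<nu> \<rho> u \<phi>"
    and mass: "\<And>t. t \<ge> 0 \<Longrightarrow> (LBINT x:torus. \<rho> t x) = 1"
    and rho_bounds: "\<And>t x. t \<ge> 0 \<Longrightarrow> \<rho>\<^sub>m \<le> \<rho> t x \<and> \<rho> t x \<le> \<rho>\<^sub>p"
begin

abbreviation "u\<^sub>x \<equiv> partial_x u"
abbreviation "\<rho>\<^sub>x \<equiv> partial_x \<rho>"
abbreviation "\<phi>\<^sub>x \<equiv> partial_x \<phi>"
abbreviation "\<phi>\<^sub>x\<^sub>x \<equiv> partial_x (partial_x \<phi>)"
abbreviation "u\<^sub>t \<equiv> partial_t u"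
abbreviation "\<rho>\<^sub>t \<equiv> partial_t \<rho>"

text \<open>The momentum, which is also the mass flux.\<close>

definition q :: "real \<Rightarrow> real \<Rightarrow> real" where "q t x = \<rho> t x * u t x"

lemma rho_pos: "t \<ge> 0 \<Longrightarrow> \<rho> t x > 0"
  using rho_bounds[of t x] rhom_pos by linarith

lemma periodic:
  assumes "t \<ge> 0"
  shows "\<rho> t (x + 1) = \<rho> t x" "u t (x + 1) = u t x" "\<phi> t (x + 1) = \<phi> t x"
  using sol assms by (auto simp: classical_solution_def)

lemma joint:
  "continuous_on ({0..} \<times> UNIV) (\<lambda>(t, x). \<rho> t x)" "continuous_on ({0..} \<times> UNIV) (\<lambda>(t, x). u t x)"
  "continuous_on ({0..} \<times> UNIV) (\<lambda>(t, x). u\<^sub>x t x)" "continuous_on ({0..} \<times> UNIV) (\<lambda>(t, x). \<phi> t x)"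
  "continuous_on ({0..} \<times> UNIV) (\<lambda>(t, x). \<phi>\<^sub>x t x)" "continuous_on ({0..} \<times> UNIV) (\<lambda>(t, x). \<phi>\<^sub>x\<^sub>x t x)"
  using sol by (simp_all add: classical_solution_def jointly_continuous_def)

lemma joint_pos:
  "continuous_on ({0<..} \<times> UNIV) (\<lambda>(t, x). \<rho>\<^sub>t t x)" "continuous_on ({0<..} \<times> UNIV) (\<lambda>(t, x). \<rho>\<^sub>x t x)"
  "continuous_on ({0<..} \<times> UNIV) (\<lambda>(t, x). u\<^sub>t t x)"
  using sol by (simp_all add: classical_solution_def C1_spacetime_def jointly_continuous_def)

lemma joint_pos':
  "continuous_on ({0<..} \<times> UNIV) (\<lambda>(t, x). \<rho> t x)" "continuous_on ({0<..} \<times> UNIV) (\<lambda>(t, x). u t x)"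
  "continuous_on ({0<..} \<times> UNIV) (\<lambda>(t, x). u\<^sub>x t x)" "continuous_on ({0<..} \<times> UNIV) (\<lambda>(t, x). \<phi>\<^sub>x t x)"
  by (rule continuous_on_subset[OF joint(1)] continuous_on_subset[OF joint(2)]
      continuous_on_subset[OF joint(3)] continuous_on_subset[OF joint(5)]; auto)+

lemmas slice = joint[THEN continuous_on_slice, simplified]
lemmas slice_pos = joint_pos[THEN continuous_on_slice, simplified]

lemma deriv_x:
  assumes "t \<ge> 0"
  shows "(u t has_real_derivative u\<^sub>x t x) (at x)" "(\<phi> t has_real_derivative \<phi>\<^sub>x t x) (at x)"
    "(\<phi>\<^sub>x t has_real_derivative \<phi>\<^sub>x\<^sub>x t x) (at x)"
  using sol assms unfolding classical_solution_def differentiable_x_def partial_x_def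
  by (auto simp: DERIV_deriv_iff_real_differentiable)

lemma deriv_pos:
  assumes "t > 0"
  shows "(\<rho> t has_real_derivative \<rho>\<^sub>x t x) (at x)"
    "((\<lambda>s. \<rho> s x) has_real_derivative \<rho>\<^sub>t t x) (at t)" "((\<lambda>s. u s x) has_real_derivative u\<^sub>t t x) (at t)"
  using sol assms unfolding classical_solution_def C1_spacetime_def differentiable_x_def
    differentiable_t_def partial_x_def partial_t_def
  by (auto simp: DERIV_deriv_iff_real_differentiable)

lemma deriv_q:
  assumes "t > 0"
  shows "(q t has_real_derivative \<rho>\<^sub>x t x * u t x + \<rho> t x * u\<^sub>x t x) (at x)"
  unfolding q_def using assms
  by (auto intro!: derivative_eq_intros deriv_pos deriv_x)

lemma continuity_eq:
  assumes "t > 0" shows "\<rho>\<^sub>t t x = - (\<rho>\<^sub>x t x * u t x + \<rho> t x * u\<^sub>x t x)"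
proof -
  have "partial_x (\<lambda>s y. \<rho> s y * u s y) t x = \<rho>\<^sub>x t x * u t x + \<rho> t x * u\<^sub>x t x"
    unfolding partial_x_def using DERIV_imp_deriv[OF deriv_q[OF assms, of x]]
    by (simp add: partial_x_def flip: q_def)
  moreover have "\<rho>\<^sub>t t x + partial_x (\<lambda>s y. \<rho> s y * u s y) t x = 0"
    using sol assms unfolding classical_solution_def by blast
  ultimately show ?thesis by linarith
qed

lemma momentum_eq:
  assumes "t > 0" shows "u\<^sub>t t x = - (u t x * u\<^sub>x t x) - \<nu> * u t x - \<phi>\<^sub>x t x"
proof -
  have "u\<^sub>t t x + u t x * u\<^sub>x t x = - \<nu> * u t x - \<phi>\<^sub>x t x"
    using sol assms unfolding classical_solution_def by blast
  thus ?thesis by linarith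
qed

lemma poisson_eq: "t \<ge> 0 \<Longrightarrow> \<phi>\<^sub>x\<^sub>x t x = exp (\<phi> t x) - \<rho> t x"
  using sol unfolding classical_solution_def by (metis add.inverse_inverse minus_diff_eq)

lemma periodic_phi_x:
  assumes "t \<ge> 0" shows "\<phi>\<^sub>x t (x + 1) = \<phi>\<^sub>x t x"
  by (rule periodic_derivative[of "\<phi> t"]) (use assms deriv_x periodic in auto)

lemma periodic_u_x:
  assumes "t \<ge> 0" shows "u\<^sub>x t (x + 1) = u\<^sub>x t x"
  by (rule periodic_derivative[of "u t"]) (use assms deriv_x periodic in auto)

lemma pint_rho: "t \<ge> 0 \<Longrightarrow> pint (\<rho> t) = 1"
  using mass[of t] LBINT_torus[OF slice(1)] by simp

lemma pint_exp_phi: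
  assumes "t \<ge> 0" shows "pint (\<lambda>x. exp (\<phi> t x)) = 1"
proof -
  have "pint (\<lambda>x. exp (\<phi> t x)) = pint (\<lambda>x. \<rho> t x + \<phi>\<^sub>x\<^sub>x t x)"
    using poisson_eq[OF assms] by simp
  also have "\<dots> = pint (\<rho> t) + pint (\<phi>\<^sub>x\<^sub>x t)"
    using assms by (intro pint_add slice) auto
  also have "pint (\<phi>\<^sub>x\<^sub>x t) = 0"
    using assms by (intro pint_deriv_eq_0[of "\<phi>\<^sub>x t"] deriv_x periodic_phi_x) auto
  finally show ?thesis using pint_rho[OF assms] by simp
qed

lemma phi_zero:
  assumes "t \<ge> 0" obtains x where "x \<in> {-1/2..1/2}" "\<phi> t x = 0"
proof (rule pint_eq_0_zero[of "\<lambda>x. exp (\<phi> t x) - 1"])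
  show "continuous_on UNIV (\<lambda>x. exp (\<phi> t x) - 1)"
    by (intro continuous_intros slice assms)
  show "pint (\<lambda>x. exp (\<phi> t x) - 1) = 0"
    using assms by (subst pint_diff) (auto intro!: continuous_intros slice simp: pint_exp_phi)
qed (use that in auto)

lemma phi_x_zero:
  assumes "t \<ge> 0" obtains x where "x \<in> {-1/2..1/2}" "\<phi>\<^sub>x t x = 0"
proof (rule pint_eq_0_zero[of "\<phi>\<^sub>x t"])
  show "pint (\<phi>\<^sub>x t) = 0"
    using assms by (intro pint_deriv_eq_0[of "\<phi> t"] deriv_x periodic) auto
qed (use assms that slice in auto)

text \<open>Since \<phi>_x vanishes somewhere, it is bounded by the integral of
  \<bar>\<phi>_xx\<bar>, hence by that of e^\<phi> + \<rho>, and both have mass one. The bound is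
  absolute, which is why exp 2, exp 4 and exp 6 appear below as constants.\<close>

lemma phi_x_le_2:
  assumes t: "t \<ge> 0" and x: "x \<in> {-1/2..1/2}" shows "\<bar>\<phi>\<^sub>x t x\<bar> \<le> 2"
proof -
  obtain y where y: "y \<in> {-1/2..1/2}" "\<phi>\<^sub>x t y = 0" using phi_x_zero[OF t] .
  have "\<bar>\<phi>\<^sub>x t x\<bar> = \<bar>\<phi>\<^sub>x t x - \<phi>\<^sub>x t y\<bar>" using y by simp
  also have "\<dots> \<le> pint (\<lambda>x. \<bar>\<phi>\<^sub>x\<^sub>x t x\<bar>)"
    by (intro diff_le_pint_abs deriv_x slice t x y)
  also have "\<dots> \<le> pint (\<lambda>x. exp (\<phi> t x) + \<rho> t x)"
  proof (intro pint_mono continuous_intros slice t)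
    fix x show "\<bar>\<phi>\<^sub>x\<^sub>x t x\<bar> \<le> exp (\<phi> t x) + \<rho> t x"
      using rho_pos[OF t, of x] by (simp add: poisson_eq[OF t] abs_le_iff)
  qed
  also have "\<dots> = 2"
    using t by (subst pint_add) (auto intro!: continuous_intros slice simp: pint_exp_phi pint_rho)
  finally show ?thesis .
qed

lemma phi_le_2:
  assumes t: "t \<ge> 0" shows "\<bar>\<phi> t x\<bar> \<le> 2"
proof (rule periodic_reduce[of "\<phi> t"])
  fix x :: real assume x: "x \<in> {-1/2..1/2}"
  obtain y where y: "y \<in> {-1/2..1/2}" "\<phi> t y = 0" using phi_zero[OF t] .
  have "\<bar>\<phi> t x\<bar> = \<bar>\<phi> t x - \<phi> t y\<bar>" using y by simp
  also have "\<dots> \<le> pint (\<lambda>x. \<bar>\<phi>\<^sub>x t x\<bar>)"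
    by (intro diff_le_pint_abs deriv_x slice t x y)
  also have "\<dots> \<le> pint (\<lambda>x. 2)"
    by (intro pint_mono continuous_intros slice t phi_x_le_2)
  finally show "\<bar>\<phi> t x\<bar> \<le> 2" by simp
qed (use periodic t in auto)

text \<open>Neutrality makes e^\<phi> - 1 of mean zero, so \<phi> has a zero and the Poincare bound
  applies.\<close>

lemma phi_power2_le:
  assumes t: "t \<ge> 0" shows "(\<phi> t x)\<^sup>2 \<le> pint (\<lambda>x. (\<phi>\<^sub>x t x)\<^sup>2)"
proof (rule periodic_reduce[of "\<phi> t"])
  fix x :: real assume x: "x \<in> {-1/2..1/2}"
  obtain y where y: "y \<in> {-1/2..1/2}" "\<phi> t y = 0" using phi_zero[OF t] .
  show "(\<phi> t x)\<^sup>2 \<le> pint (\<lambda>x. (\<phi>\<^sub>x t x)\<^sup>2)"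
    by (rule power2_le_pint_deriv[of "\<phi> t", OF _ _ y(2)]) (use t x y deriv_x slice in auto)
qed (use periodic t in auto)

text \<open>The net mass that has crossed x = 0 up to time \<open>t\<close>.\<close>

definition J :: "real \<Rightarrow> real" where "J t = integral {0..t} (\<lambda>s. q s 0)"

text \<open>A stream function: \<open>\<partial>\<^sub>x F = \<rho>\<close> and \<open>\<partial>\<^sub>t F = - \<rho> u\<close>, so that the characteristics are the
  level curves of \<open>F\<close>.\<close>
definition F :: "real \<Rightarrow> real \<Rightarrow> real" where "F t x = antideriv (\<rho> t) x - J t"

lemma F_x:
  assumes "t \<ge> 0" shows "(F t has_real_derivative \<rho> t x) (at x)"
  unfolding F_def using assms by (auto intro!: derivative_eq_intros antideriv_derivative slice)

lemma joint_q: "continuous_on ({0..} \<times> UNIV) (\<lambda>(t, x). q t x)"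
  using continuous_on_mult[OF joint(1,2)] by (simp add: q_def case_prod_unfold)

lemma slice_q: "t \<ge> 0 \<Longrightarrow> continuous_on UNIV (q t)"
  using joint_q[THEN continuous_on_slice] by simp

lemma q_at_0_continuous: "continuous_on {0..} (\<lambda>s. q s x)"
proof -
  have "continuous_on {0..} (\<lambda>s. (\<lambda>(t, x). q t x) (s, x))"
    by (rule continuous_on_compose2[OF joint_q]) (auto intro!: continuous_intros)
  thus ?thesis by simp
qed

lemma J_deriv:
  assumes "t > 0" shows "(J has_real_derivative q t 0) (at t)"
proof -
  have t: "t \<in> interior {0..t+1}" using assms by simp
  have "(J has_real_derivative q t 0) (at t within {0..t+1})"
    unfolding J_def
    by (rule integral_has_real_derivative)
       (use assms in \<open>auto intro!: continuous_on_subset[OF q_at_0_continuous]\<close>)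
  thus ?thesis using at_within_interior[OF t] by simp
qed

lemma J_continuous: "continuous_on {0..} J"
proof -
  have "continuous (at t within {0..}) J" if "t \<ge> 0" for t
  proof -
    have "(\<lambda>s. q s 0) integrable_on {0..t+1}"
      by (intro integrable_continuous_interval continuous_on_subset[OF q_at_0_continuous]) auto
    hence "continuous_on {0..t+1} J"
      unfolding J_def by (rule indefinite_integral_continuous_1)
    hence "continuous (at t within {0..t+1}) J"
      using that by (simp add: continuous_on_eq_continuous_within)
    moreover have "at t within {0..t+1} = at t within {0..}"
      by (rule at_within_nhd[of _ "{..<t+1}"]) auto
    ultimately show ?thesis by simp
  qed
  thus ?thesis by (simp add: continuous_on_eq_continuous_within)
qed

lemma F_continuous_t: "continuous_on {0..} (\<lambda>s. F s x)"
  unfolding F_def antideriv_def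
  by (intro continuous_intros continuous_on_integral_param joint J_continuous)

text \<open>By the continuity equation the antiderivative of \<rho>_t is - q normalised to vanish at
  0; subtracting \<open>J\<close> removes the normalisation.\<close>

lemma F_t:
  assumes "t > 0" shows "((\<lambda>s. F s x) has_real_derivative - q t x) (at t)"
proof -
  have "antideriv (\<rho>\<^sub>t t) x = (- q t x) - (- q t 0)"
  proof (rule antideriv_eq)
    show "continuous_on UNIV (\<rho>\<^sub>t t)" using assms by (intro slice_pos)
    show "((\<lambda>x. - q t x) has_real_derivative \<rho>\<^sub>t t x) (at x)" for x
      using continuity_eq[OF assms, of x] by (auto intro!: derivative_eq_intros deriv_q assms)
  qed
  moreover have "((\<lambda>s. antideriv (\<rho> s) x) has_real_derivative antideriv (\<rho>\<^sub>t t) x) (at t)"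
    by (rule leibniz_antideriv[of "{0<..}"]) (use assms deriv_pos joint_pos slice in auto)
  ultimately show ?thesis
    unfolding F_def by (auto intro!: derivative_eq_intros J_deriv assms)
qed

text \<open>The unit mass makes the shift the same at all times, so F s - F t is one-periodic and
  integration by parts against it leaves no boundary term.\<close>

lemma F_shift:
  assumes t: "t \<ge> 0" shows "F t (x + 1) = F t x + 1"
proof -
  have "((\<lambda>x. F t (x + 1) - F t x) has_real_derivative 0) (at x)" for x
  proof -
    have "((\<lambda>x. F t (x + 1)) has_real_derivative \<rho> t (x + 1)) (at x)"
      using F_x[OF t, of "x + 1"] by (simp add: DERIV_shift)
    from DERIV_diff[OF this F_x[OF t]] show ?thesis by (simp add: periodic[OF t])
  qed
  from DERIV_isconst_all[rule_format, OF this, of x "-1/2"]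
  have "F t (x + 1) - F t x = F t (1/2) - F t (-1/2)" by simp
  also have "(\<rho> t has_integral F t (1/2) - F t (-1/2)) {-1/2..1/2}"
    by (intro fundamental_theorem_of_calculus)
       (auto intro!: has_field_derivative_at_within F_x t
             simp: has_real_derivative_iff_has_vector_derivative[symmetric])
  hence "F t (1/2) - F t (-1/2) = 1" using pint_rho[OF t] by (simp add: pint_def integral_unique)
  finally show ?thesis by simp
qed

end

section \<open>Decay of the free energy\<close>

text \<open>The factors of the integral of \<rho> u^2 produced by the cross term: exp 2 bounds
  \<phi>_xx, \<nu>^2 / 2 comes from the friction, and \<open>\<rho>\<^sub>p\<close> from the motion
  of \<phi>_x in time.\<close>

definition energy_coeff :: "real \<Rightarrow> real \<Rightarrow> real" where
  "energy_coeff \<nu> \<rho>\<^sub>p = exp 2 + \<nu>\<^sup>2 / 2 + \<rho>\<^sub>p"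

text \<open>The first bound keeps the cross term below half of the energy, the second below half of
  the friction.\<close>

definition energy_eps :: "real \<Rightarrow> real \<Rightarrow> real" where
  "energy_eps \<nu> \<rho>\<^sub>p = min (1 / (2 * (1 + \<rho>\<^sub>p))) (\<nu> / (2 * energy_coeff \<nu> \<rho>\<^sub>p))"

text \<open>2/3 inverts the bound of \<open>lyapunov\<close> by 3/2 of the energy, and 1 + exp 4 is
  the cost of bounding the potential energy by the integral of \<phi>_x^2.\<close>

definition energy_rate :: "real \<Rightarrow> real \<Rightarrow> real \<Rightarrow> real" where
  "energy_rate \<nu> \<rho>\<^sub>m \<rho>\<^sub>p = 2 / 3 * min \<nu> (energy_eps \<nu> \<rho>\<^sub>p * \<rho>\<^sub>m / (1 + exp 4))"

lemma energy_constants_pos: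
  assumes "\<nu> > 0" "\<rho>\<^sub>p > 0"
  shows "energy_coeff \<nu> \<rho>\<^sub>p > 0" "energy_eps \<nu> \<rho>\<^sub>p > 0"
    "energy_eps \<nu> \<rho>\<^sub>p * (1 + \<rho>\<^sub>p) \<le> 1 / 2" "energy_eps \<nu> \<rho>\<^sub>p * energy_coeff \<nu> \<rho>\<^sub>p \<le> \<nu> / 2"
proof -
  show A: "energy_coeff \<nu> \<rho>\<^sub>p > 0"
    using assms by (auto simp: energy_coeff_def intro!: add_pos_pos)
  show "energy_eps \<nu> \<rho>\<^sub>p > 0" using A assms by (simp add: energy_eps_def)
  have "energy_eps \<nu> \<rho>\<^sub>p \<le> 1 / (2 * (1 + \<rho>\<^sub>p))" unfolding energy_eps_def by (rule min.cobounded1)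
  thus "energy_eps \<nu> \<rho>\<^sub>p * (1 + \<rho>\<^sub>p) \<le> 1 / 2" using assms by (simp add: field_simps)
  have "energy_eps \<nu> \<rho>\<^sub>p \<le> \<nu> / (2 * energy_coeff \<nu> \<rho>\<^sub>p)" unfolding energy_eps_def by (rule min.cobounded2)
  thus "energy_eps \<nu> \<rho>\<^sub>p * energy_coeff \<nu> \<rho>\<^sub>p \<le> \<nu> / 2" using A by (simp add: field_simps)
qed

lemma energy_rate_pos: "\<lbrakk>\<nu> > 0; \<rho>\<^sub>m > 0; \<rho>\<^sub>p > 0\<rbrakk> \<Longrightarrow> energy_rate \<nu> \<rho>\<^sub>m \<rho>\<^sub>p > 0"
  using energy_constants_pos(2)[of \<nu> \<rho>\<^sub>p] by (auto simp: energy_rate_def add_pos_pos)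

context euler_poisson
begin

section \<open>Time increments of the potential through the stream function\<close>

lemma F_continuous_x: "t \<ge> 0 \<Longrightarrow> continuous_on UNIV (F t)"
  using F_x by (auto intro!: DERIV_continuous_on)

text \<open>The Poisson equation at two times, subtracted and tested against \<open>g\<close>.\<close>
lemma poisson_weak_diff:
  assumes ts: "t \<ge> 0" "s \<ge> 0"
    and g: "\<And>x. (g has_real_derivative g' x) (at x)" "\<And>x. g (x + 1) = g x" "continuous_on UNIV g'"
  shows "pint (\<lambda>x. g' x * (\<phi>\<^sub>x s x - \<phi>\<^sub>x t x)) + pint (\<lambda>x. g x * (exp (\<phi> s x) - exp (\<phi> t x)))
    = - pint (\<lambda>x. g' x * (F s x - F t x))"
proof -
  have cg: "continuous_on UNIV g" using g(1) by (auto intro!: DERIV_continuous_on)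
  note c = continuous_intros slice ts cg g(3)
  have 1: "pint (\<lambda>x. g x * (\<phi>\<^sub>x\<^sub>x s x - \<phi>\<^sub>x\<^sub>x t x)) = - pint (\<lambda>x. g' x * (\<phi>\<^sub>x s x - \<phi>\<^sub>x t x))"
    by (rule pint_by_parts)
       (auto intro!: g c DERIV_diff deriv_x simp: periodic_phi_x ts)
  have 2: "pint (\<lambda>x. g x * (\<rho> s x - \<rho> t x)) = - pint (\<lambda>x. g' x * (F s x - F t x))"
    by (rule pint_by_parts)
       (auto intro!: g c DERIV_diff F_x simp: F_shift ts)
  have "pint (\<lambda>x. g x * (exp (\<phi> s x) - exp (\<phi> t x)))
      = pint (\<lambda>x. g x * (\<phi>\<^sub>x\<^sub>x s x - \<phi>\<^sub>x\<^sub>x t x) + g x * (\<rho> s x - \<rho> t x))"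
    using ts by (simp add: poisson_eq algebra_simps)
  also have "\<dots> = pint (\<lambda>x. g x * (\<phi>\<^sub>x\<^sub>x s x - \<phi>\<^sub>x\<^sub>x t x)) + pint (\<lambda>x. g x * (\<rho> s x - \<rho> t x))"
    by (intro pint_add c)
  finally show ?thesis using 1 2 by simp
qed

text \<open>Test with the increment of \<phi> itself: the exponential term has a sign because exp is
  increasing, and Young's inequality absorbs half of the gradient term.\<close>

lemma phi_x_diff_le:
  assumes ts: "t \<ge> 0" "s \<ge> 0"
  shows "pint (\<lambda>x. (\<phi>\<^sub>x s x - \<phi>\<^sub>x t x)\<^sup>2) \<le> pint (\<lambda>x. (F s x - F t x)\<^sup>2)"
proof -
  note c = continuous_intros slice F_continuous_x ts
  let ?g = "\<lambda>x. \<phi> s x - \<phi> t x" and ?g' = "\<lambda>x. \<phi>\<^sub>x s x - \<phi>\<^sub>x t x" and ?f = "\<lambda>x. F s x - F t x"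
  have "pint (\<lambda>x. ?g' x * ?g' x) + pint (\<lambda>x. ?g x * (exp (\<phi> s x) - exp (\<phi> t x))) = - pint (\<lambda>x. ?g' x * ?f x)"
    by (rule poisson_weak_diff) (auto intro!: c DERIV_diff deriv_x simp: periodic ts)
  moreover have "0 \<le> pint (\<lambda>x. ?g x * (exp (\<phi> s x) - exp (\<phi> t x)))"
    by (intro pint_nonneg c) (auto simp: zero_le_mult_iff)
  moreover have "- pint (\<lambda>x. ?g' x * ?f x) \<le> 1 / 2 * pint (\<lambda>x. (?g' x)\<^sup>2) + 1 / 2 * pint (\<lambda>x. (?f x)\<^sup>2)"
  proof -
    have "pint (\<lambda>x. - (?g' x * ?f x)) \<le> pint (\<lambda>x. 1 / 2 * (?g' x)\<^sup>2 + 1 / 2 * (?f x)\<^sup>2)"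
    proof (intro pint_mono c)
      fix x
      have "0 \<le> (?g' x + ?f x)\<^sup>2" by simp
      thus "- (?g' x * ?f x) \<le> 1 / 2 * (?g' x)\<^sup>2 + 1 / 2 * (?f x)\<^sup>2"
        unfolding power2_sum by argo
    qed
    also have "\<dots> = pint (\<lambda>x. 1 / 2 * (?g' x)\<^sup>2) + pint (\<lambda>x. 1 / 2 * (?f x)\<^sup>2)"
      by (intro pint_add c)
    finally show ?thesis unfolding pint_cmult pint_minus .
  qed
  ultimately show ?thesis unfolding power2_eq_square by argo
qed

text \<open>Both exponentials have mean one, so the potentials at the two times agree at some
  point.\<close>

lemma phi_diff_power2_le:
  assumes ts: "t \<ge> 0" "s \<ge> 0" and x: "x \<in> {-1/2..1/2}"
  shows "(\<phi> s x - \<phi> t x)\<^sup>2 \<le> pint (\<lambda>x. (F s x - F t x)\<^sup>2)"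
proof -
  note c = continuous_intros slice ts
  obtain y where y: "y \<in> {-1/2..1/2}" "exp (\<phi> s y) - exp (\<phi> t y) = 0"
  proof (rule pint_eq_0_zero[of "\<lambda>x. exp (\<phi> s x) - exp (\<phi> t x)"])
    show "pint (\<lambda>x. exp (\<phi> s x) - exp (\<phi> t x)) = 0"
      using ts by (subst pint_diff) (auto intro!: c simp: pint_exp_phi)
  qed (auto intro!: c)
  have "(\<phi> s x - \<phi> t x)\<^sup>2 \<le> pint (\<lambda>x. (\<phi>\<^sub>x s x - \<phi>\<^sub>x t x)\<^sup>2)"
    by (rule power2_le_pint_deriv[OF _ _ _ x y(1)]) (use y(2) in \<open>auto intro!: c DERIV_diff deriv_x\<close>)
  also note phi_x_diff_le[OF ts]
  finally show ?thesis .
qed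

section \<open>The parts of the energy, their increments and rates\<close>

definition kinetic :: "real \<Rightarrow> real" where
  "kinetic t = pint (\<lambda>x. 1 / 2 * (\<rho> t x * (u t x)\<^sup>2))"

definition potential :: "real \<Rightarrow> real" where
  "potential t = pint (\<lambda>x. 1 / 2 * (\<phi>\<^sub>x t x)\<^sup>2 + (exp (\<phi> t x) * (\<phi> t x - 1) + 1))"

definition cross :: "real \<Rightarrow> real" where
  "cross t = pint (\<lambda>x. q t x * \<phi>\<^sub>x t x)"

lemma free_energy_eq:
  assumes t: "t \<ge> 0" shows "free_energy \<rho> u \<phi> t = kinetic t + potential t"
proof -
  note c = continuous_intros slice t
  have "free_energy \<rho> u \<phi> t = pint (\<lambda>x. 1/2 * \<rho> t x * (u t x)\<^sup>2 + 1/2 * (\<phi>\<^sub>x t x)\<^sup>2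
        + exp (\<phi> t x) * (\<phi> t x - 1) + 1)"
    unfolding free_energy_def by (intro LBINT_torus c)
  also have "\<dots> = pint (\<lambda>x. 1/2 * (\<rho> t x * (u t x)\<^sup>2) +
      (1 / 2 * (\<phi>\<^sub>x t x)\<^sup>2 + (exp (\<phi> t x) * (\<phi> t x - 1) + 1)))"
    by (simp add: algebra_simps)
  also have "\<dots> = kinetic t + potential t"
    unfolding kinetic_def potential_def by (intro pint_add c)
  finally show ?thesis .
qed

text \<open>A first-order expansion at time \<open>t\<close>. The linear part is the weak Poisson
  increment tested against \<phi> t, which turns it into an integral against F s - F t; the
  remainder is quadratic in the increment of \<phi>.\<close>

lemma potential_diff_le:
  assumes ts: "t \<ge> 0" "s \<ge> 0"
  shows "potential s - potential t \<le> - pint (\<lambda>x. \<phi>\<^sub>x t x * (F s x - F t x))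
    + (1 / 2 + exp 6 / 2) * pint (\<lambda>x. (F s x - F t x)\<^sup>2)"
proof -
  note c = continuous_intros slice F_continuous_x ts
  define P where "P = pint (\<lambda>x. (F s x - F t x)\<^sup>2)"
  let ?g = "\<lambda>x. \<phi> s x - \<phi> t x" and ?g' = "\<lambda>x. \<phi>\<^sub>x s x - \<phi>\<^sub>x t x" and ?f = "\<lambda>x. F s x - F t x"
  let ?e = "\<lambda>x. exp (\<phi> s x) - exp (\<phi> t x)"
  have "potential s - potential t = pint (\<lambda>x. (1 / 2 * (\<phi>\<^sub>x s x)\<^sup>2 + (exp (\<phi> s x) * (\<phi> s x - 1) + 1))
      - (1 / 2 * (\<phi>\<^sub>x t x)\<^sup>2 + (exp (\<phi> t x) * (\<phi> t x - 1) + 1)))"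
    unfolding potential_def by (intro pint_diff[symmetric] c)
  also have "\<dots> \<le> pint (\<lambda>x. (\<phi>\<^sub>x t x * ?g' x + \<phi> t x * ?e x) + (1 / 2 * (?g' x)\<^sup>2 + exp 6 / 2 * P))"
  proof (intro pint_mono c)
    fix x :: real assume x: "x \<in> {-1/2..1/2}"
    \<comment> \<open>The increment is at most 4, so the Taylor remainder carries exp 4; the
      prefactor e^\<phi> at time s contributes exp 2, together exp 6.\<close>
    have "\<bar>- ?g x\<bar> \<le> 4" using phi_le_2[OF ts(1), of x] phi_le_2[OF ts(2), of x] by linarith
    note R = exp_remainder_le[OF this, unfolded power2_minus]
    have "exp (\<phi> s x) * (exp (- ?g x) - 1 - (- ?g x)) \<le> exp 2 * (exp 4 / 2 * (?g x)\<^sup>2)"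
      using phi_le_2[OF ts(2), of x] R by (intro mult_mono) auto
    also have "\<dots> = exp 6 / 2 * (?g x)\<^sup>2" by (simp flip: exp_add)
    also have "\<dots> \<le> exp 6 / 2 * P"
      unfolding P_def by (intro mult_left_mono phi_diff_power2_le ts x) auto
    also have "exp (\<phi> s x) * (exp (- ?g x) - 1 - (- ?g x)) = exp (\<phi> t x) + exp (\<phi> s x) * (?g x - 1)"
      by (simp add: algebra_simps flip: exp_add)
    finally have "exp (\<phi> t x) + exp (\<phi> s x) * (?g x - 1) \<le> exp 6 / 2 * P" .
    moreover have "1 / 2 * (\<phi>\<^sub>x s x)\<^sup>2 - 1 / 2 * (\<phi>\<^sub>x t x)\<^sup>2 = \<phi>\<^sub>x t x * ?g' x + 1 / 2 * (?g' x)\<^sup>2"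
      by (simp add: power2_eq_square field_simps)
    moreover have "exp (\<phi> s x) * (\<phi> s x - 1) - exp (\<phi> t x) * (\<phi> t x - 1)
        = \<phi> t x * ?e x + (exp (\<phi> t x) + exp (\<phi> s x) * (?g x - 1))"
      by (simp add: algebra_simps)
    ultimately show "1 / 2 * (\<phi>\<^sub>x s x)\<^sup>2 + (exp (\<phi> s x) * (\<phi> s x - 1) + 1)
      - (1 / 2 * (\<phi>\<^sub>x t x)\<^sup>2 + (exp (\<phi> t x) * (\<phi> t x - 1) + 1))
      \<le> (\<phi>\<^sub>x t x * ?g' x + \<phi> t x * ?e x) + (1 / 2 * (?g' x)\<^sup>2 + exp 6 / 2 * P)"
      by linarith
  qed
  also have "\<dots> = pint (\<lambda>x. \<phi>\<^sub>x t x * ?g' x) + pint (\<lambda>x. \<phi> t x * ?e x)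
      + (1 / 2 * pint (\<lambda>x. (?g' x)\<^sup>2) + exp 6 / 2 * P)"
    by (simp add: pint_add pint_cmult c del: times_divide_eq_left)
  also have "pint (\<lambda>x. \<phi>\<^sub>x t x * ?g' x) + pint (\<lambda>x. \<phi> t x * ?e x) = - pint (\<lambda>x. \<phi>\<^sub>x t x * ?f x)"
    by (rule poisson_weak_diff) (use ts deriv_x periodic slice in auto)
  also have "1 / 2 * pint (\<lambda>x. (?g' x)\<^sup>2) + exp 6 / 2 * P \<le> 1 / 2 * P + exp 6 / 2 * P"
    using phi_x_diff_le[OF ts] by (simp add: P_def)
  finally show ?thesis unfolding P_def by (simp add: algebra_simps)
qed

text \<open>Young's inequality with weight s - t on q times the increment of \<phi>_x: the last
  integral is of order (s - t)^2, so both resulting terms are of first order in s - t. They survive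
  in the rate and account for \<open>\<rho>\<^sub>p\<close> in \<open>energy_coeff\<close>.\<close>

lemma cross_diff_le:
  assumes ts: "t \<ge> 0" "s > t"
  shows "cross s - cross t \<le> pint (\<lambda>x. q s x * \<phi>\<^sub>x t x) - pint (\<lambda>x. q t x * \<phi>\<^sub>x t x)
    + (s - t) / 2 * pint (\<lambda>x. (q s x)\<^sup>2) + 1 / (2 * (s - t)) * pint (\<lambda>x. (F s x - F t x)\<^sup>2)"
proof -
  define h where "h = s - t"
  have h: "h > 0" and s: "s \<ge> 0" using ts by (auto simp: h_def)
  note c = continuous_intros slice slice_q F_continuous_x ts(1) s
  let ?g' = "\<lambda>x. \<phi>\<^sub>x s x - \<phi>\<^sub>x t x"
  have "cross s - pint (\<lambda>x. q s x * \<phi>\<^sub>x t x) = pint (\<lambda>x. q s x * \<phi>\<^sub>x s x - q s x * \<phi>\<^sub>x t x)"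
    unfolding cross_def by (intro pint_diff[symmetric] c)
  also have "\<dots> \<le> pint (\<lambda>x. h / 2 * (q s x)\<^sup>2 + 1 / (2 * h) * (?g' x)\<^sup>2)"
  proof (intro pint_mono c)
    fix x
    have "0 \<le> 1 / (2 * h) * (h * q s x - ?g' x)\<^sup>2" using h by simp
    also have "\<dots> = h / 2 * (q s x)\<^sup>2 + 1 / (2 * h) * (?g' x)\<^sup>2 - (q s x * \<phi>\<^sub>x s x - q s x * \<phi>\<^sub>x t x)"
      using h by (simp add: power2_eq_square field_simps)
    finally show "q s x * \<phi>\<^sub>x s x - q s x * \<phi>\<^sub>x t x \<le> h / 2 * (q s x)\<^sup>2 + 1 / (2 * h) * (?g' x)\<^sup>2" by simp
  qed
  also have "\<dots> = pint (\<lambda>x. h / 2 * (q s x)\<^sup>2) + pint (\<lambda>x. 1 / (2 * h) * (?g' x)\<^sup>2)"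
    by (intro pint_add c)
  also have "\<dots> = h / 2 * pint (\<lambda>x. (q s x)\<^sup>2) + 1 / (2 * h) * pint (\<lambda>x. (?g' x)\<^sup>2)"
    unfolding pint_cmult ..
  also have "1 / (2 * h) * pint (\<lambda>x. (?g' x)\<^sup>2) \<le> 1 / (2 * h) * pint (\<lambda>x. (F s x - F t x)\<^sup>2)"
    using h by (intro mult_left_mono phi_x_diff_le ts s) auto
  finally show ?thesis unfolding h_def cross_def by linarith
qed

abbreviation k_int :: "real \<Rightarrow> real" where "k_int t \<equiv> pint (\<lambda>x. \<rho> t x * (u t x)\<^sup>2)"
abbreviation w_int :: "real \<Rightarrow> real" where "w_int t \<equiv> pint (\<lambda>x. (\<phi>\<^sub>x t x)\<^sup>2)"

lemma kinetic_eq: "kinetic t = 1 / 2 * k_int t"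
  unfolding kinetic_def pint_cmult ..

lemma k_int_nonneg: "t \<ge> 0 \<Longrightarrow> 0 \<le> k_int t"
  by (intro pint_nonneg continuous_intros slice mult_nonneg_nonneg less_imp_le[OF rho_pos]) auto

lemma w_int_nonneg: "t \<ge> 0 \<Longrightarrow> 0 \<le> w_int t"
  by (intro pint_nonneg continuous_intros slice) auto

text \<open>The density e^\<phi> (\<phi> - 1) + 1 is e^\<phi> times the second-order Taylor
  remainder of exp at - \<phi>, hence nonnegative and at most exp 4 / 2 times \<phi>^2.\<close>

lemma potential_bounds:
  assumes t: "t \<ge> 0"
  shows "1 / 2 * w_int t \<le> potential t" "potential t \<le> (1 + exp 4) / 2 * w_int t"
proof -
  note c = continuous_intros slice t
  have e: "exp (\<phi> t x) * (\<phi> t x - 1) + 1 = exp (\<phi> t x) * (exp (- \<phi> t x) - 1 - (- \<phi> t x))" for x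
    by (simp add: algebra_simps flip: exp_add)
  have R: "0 \<le> exp (- \<phi> t x) - 1 - (- \<phi> t x)"
    "exp (- \<phi> t x) - 1 - (- \<phi> t x) \<le> exp 2 / 2 * (\<phi> t x)\<^sup>2" for x
    using exp_remainder_le[of "- \<phi> t x" 2] phi_le_2[OF t, of x] by simp_all
  have "pint (\<lambda>x. 1 / 2 * (\<phi>\<^sub>x t x)\<^sup>2) \<le> potential t"
    unfolding potential_def e by (intro pint_mono c) (use R in simp)
  thus "1 / 2 * w_int t \<le> potential t" unfolding pint_cmult .
  have "potential t \<le> pint (\<lambda>x. 1 / 2 * (\<phi>\<^sub>x t x)\<^sup>2 + exp 4 / 2 * w_int t)"
    unfolding potential_def e
  proof (intro pint_mono c)
    fix x :: real
    have "exp (\<phi> t x) * (exp (- \<phi> t x) - 1 - (- \<phi> t x)) \<le> exp 2 * (exp 2 / 2 * (\<phi> t x)\<^sup>2)"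
      using phi_le_2[OF t, of x] R[of x] by (intro mult_mono) auto
    also have "\<dots> = exp 4 / 2 * (\<phi> t x)\<^sup>2" by (simp flip: exp_add)
    also have "\<dots> \<le> exp 4 / 2 * w_int t" by (intro mult_left_mono phi_power2_le t) auto
    finally show "1 / 2 * (\<phi>\<^sub>x t x)\<^sup>2 + exp (\<phi> t x) * (exp (- \<phi> t x) - 1 - (- \<phi> t x))
      \<le> 1 / 2 * (\<phi>\<^sub>x t x)\<^sup>2 + exp 4 / 2 * w_int t" by simp
  qed
  also have "\<dots> = 1 / 2 * w_int t + exp 4 / 2 * w_int t"
    by (subst pint_add) (auto intro!: c simp: pint_cmult simp del: times_divide_eq_left)
  finally show "potential t \<le> (1 + exp 4) / 2 * w_int t" by (simp add: field_simps)
qed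

lemma cross_bound:
  assumes t: "t \<ge> 0"
  shows "\<bar>cross t\<bar> \<le> 1 / 2 * k_int t + \<rho>\<^sub>p / 2 * w_int t"
proof -
  note c = continuous_intros slice slice_q t
  have b: "\<bar>q t x * \<phi>\<^sub>x t x\<bar> \<le> 1 / 2 * (\<rho> t x * (u t x)\<^sup>2) + \<rho>\<^sub>p / 2 * (\<phi>\<^sub>x t x)\<^sup>2" for x
  proof -
    have "\<bar>u t x * \<phi>\<^sub>x t x\<bar> \<le> 1 / 2 * (u t x)\<^sup>2 + 1 / 2 * (\<phi>\<^sub>x t x)\<^sup>2"
      using zero_le_power2[of "\<bar>u t x\<bar> - \<bar>\<phi>\<^sub>x t x\<bar>"]
      by (simp add: power2_eq_square algebra_simps abs_mult)
    hence "\<rho> t x * \<bar>u t x * \<phi>\<^sub>x t x\<bar> \<le> \<rho> t x * (1 / 2 * (u t x)\<^sup>2 + 1 / 2 * (\<phi>\<^sub>x t x)\<^sup>2)"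
      using rho_pos[OF t, of x] by (intro mult_left_mono) auto
    moreover have "\<rho> t x * (\<phi>\<^sub>x t x)\<^sup>2 \<le> \<rho>\<^sub>p * (\<phi>\<^sub>x t x)\<^sup>2"
      using rho_bounds[OF t, of x] by (intro mult_right_mono) auto
    ultimately show ?thesis using rho_pos[OF t, of x]
      by (simp add: q_def abs_mult algebra_simps)
  qed
  have "pint (\<lambda>x. 1 / 2 * (\<rho> t x * (u t x)\<^sup>2) + \<rho>\<^sub>p / 2 * (\<phi>\<^sub>x t x)\<^sup>2)
      = pint (\<lambda>x. 1 / 2 * (\<rho> t x * (u t x)\<^sup>2)) + pint (\<lambda>x. \<rho>\<^sub>p / 2 * (\<phi>\<^sub>x t x)\<^sup>2)"
    by (intro pint_add c)
  hence eq: "pint (\<lambda>x. 1 / 2 * (\<rho> t x * (u t x)\<^sup>2) + \<rho>\<^sub>p / 2 * (\<phi>\<^sub>x t x)\<^sup>2)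
      = 1 / 2 * k_int t + \<rho>\<^sub>p / 2 * w_int t" unfolding pint_cmult .
  have "pint (\<lambda>x. q t x * \<phi>\<^sub>x t x) \<le> 1 / 2 * k_int t + \<rho>\<^sub>p / 2 * w_int t"
    unfolding eq[symmetric] by (intro pint_mono c order_trans[OF abs_ge_self b])
  moreover have "pint (\<lambda>x. - (q t x * \<phi>\<^sub>x t x)) \<le> 1 / 2 * k_int t + \<rho>\<^sub>p / 2 * w_int t"
    unfolding eq[symmetric] by (intro pint_mono c order_trans[OF abs_ge_minus_self b])
  ultimately show ?thesis unfolding cross_def pint_minus by linarith
qed

lemma q_power2_le:
  assumes t: "t \<ge> 0" shows "pint (\<lambda>x. (q t x)\<^sup>2) \<le> \<rho>\<^sub>p * k_int t"
proof -
  note c = continuous_intros slice slice_q t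
  have "pint (\<lambda>x. (q t x)\<^sup>2) \<le> pint (\<lambda>x. \<rho>\<^sub>p * (\<rho> t x * (u t x)\<^sup>2))"
  proof (intro pint_mono c)
    fix x
    have "\<rho> t x * (\<rho> t x * (u t x)\<^sup>2) \<le> \<rho>\<^sub>p * (\<rho> t x * (u t x)\<^sup>2)"
      using rho_bounds[OF t, of x] rho_pos[OF t, of x] by (intro mult_right_mono) auto
    thus "(q t x)\<^sup>2 \<le> \<rho>\<^sub>p * (\<rho> t x * (u t x)\<^sup>2)"
      by (simp add: q_def power2_eq_square algebra_simps)
  qed
  thus ?thesis unfolding pint_cmult .
qed

text \<open>The transport terms combine to the exact derivative of - q u^2 / 2, which integrates to
  zero over a period; friction and the work of the field remain.\<close>

lemma kinetic_rate:
  assumes t: "t > 0"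
  shows "pint (\<lambda>x. 1 / 2 * (\<rho>\<^sub>t t x * (u t x)\<^sup>2) + q t x * u\<^sub>t t x) = - \<nu> * k_int t - cross t"
proof -
  have t0: "t \<ge> 0" using t by simp
  note c = continuous_intros slice slice_pos slice_q t0 t
  let ?q' = "\<lambda>x. \<rho>\<^sub>x t x * u t x + \<rho> t x * u\<^sub>x t x"
  let ?d = "\<lambda>x. - 1 / 2 * (?q' x * (u t x)\<^sup>2 + q t x * (2 * u t x * u\<^sub>x t x))"
  have cd: "continuous_on UNIV ?d" by (intro c)
  have "pint ?d = 0"
  proof (rule pint_deriv_eq_0[of "\<lambda>x. - 1 / 2 * (q t x * (u t x)\<^sup>2)"])
    show "((\<lambda>x. - 1 / 2 * (q t x * (u t x)\<^sup>2)) has_real_derivative ?d x) (at x)" for x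
      by (auto intro!: derivative_eq_intros deriv_q deriv_x t t0 simp: field_simps)
  qed (simp add: q_def periodic[OF t0])
  moreover have "(\<lambda>x. 1 / 2 * (\<rho>\<^sub>t t x * (u t x)\<^sup>2) + q t x * u\<^sub>t t x)
      = (\<lambda>x. ?d x - (\<nu> * (\<rho> t x * (u t x)\<^sup>2) + q t x * \<phi>\<^sub>x t x))"
    by (rule ext) (simp add: continuity_eq[OF t] momentum_eq[OF t] q_def power2_eq_square field_simps)
  moreover have "pint (\<lambda>x. ?d x - (\<nu> * (\<rho> t x * (u t x)\<^sup>2) + q t x * \<phi>\<^sub>x t x))
      = pint ?d - (pint (\<lambda>x. \<nu> * (\<rho> t x * (u t x)\<^sup>2)) + pint (\<lambda>x. q t x * \<phi>\<^sub>x t x))"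
    by (subst pint_diff[OF cd]; (subst pint_add)?) (auto intro!: c)
  ultimately show ?thesis by (simp add: cross_def pint_cmult)
qed

text \<open>Here \<phi>_x is frozen in time. Integrating the transport term by parts gives \<phi>_xx
  \<rho> u^2, where \<phi>_xx \<le> e^\<phi> \<le> exp 2. Completing the square in the friction term
  leaves half of \<rho> \<phi>_x^2, and the lower density bound makes this coercive.\<close>

lemma cross_rate:
  assumes t: "t > 0"
  shows "pint (\<lambda>x. (\<rho>\<^sub>t t x * u t x + \<rho> t x * u\<^sub>t t x) * \<phi>\<^sub>x t x)
    \<le> (exp 2 + \<nu>\<^sup>2 / 2) * k_int t - \<rho>\<^sub>m / 2 * w_int t"
proof -
  have t0: "t \<ge> 0" using t by simp
  note c = continuous_intros slice slice_pos slice_q t0 t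
  let ?q' = "\<lambda>x. \<rho>\<^sub>x t x * u t x + \<rho> t x * u\<^sub>x t x"
  let ?d = "\<lambda>x. ?q' x * u t x + q t x * u\<^sub>x t x"
  let ?r = "\<lambda>x. \<nu> * q t x * \<phi>\<^sub>x t x + \<rho> t x * (\<phi>\<^sub>x t x)\<^sup>2"
  have 1: "pint (\<lambda>x. \<phi>\<^sub>x t x * ?d x) = - pint (\<lambda>x. \<phi>\<^sub>x\<^sub>x t x * (q t x * u t x))"
  proof (rule pint_by_parts)
    show "((\<lambda>x. q t x * u t x) has_real_derivative ?d x) (at x)" for x
      by (auto intro!: derivative_eq_intros deriv_q deriv_x t t0)
    show "continuous_on UNIV ?d" by (intro c)
  qed (auto simp: q_def periodic[OF t0] periodic_phi_x[OF t0] intro!: deriv_x slice t0)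
  have "(\<lambda>x. (\<rho>\<^sub>t t x * u t x + \<rho> t x * u\<^sub>t t x) * \<phi>\<^sub>x t x) = (\<lambda>x. - (\<phi>\<^sub>x t x * ?d x) - ?r x)"
    by (rule ext) (simp add: continuity_eq[OF t] momentum_eq[OF t] q_def power2_eq_square field_simps)
  moreover have "pint (\<lambda>x. - (\<phi>\<^sub>x t x * ?d x) - ?r x) = pint (\<lambda>x. - (\<phi>\<^sub>x t x * ?d x)) - pint ?r"
    by (intro pint_diff c)
  moreover have "pint (\<lambda>x. \<phi>\<^sub>x\<^sub>x t x * (q t x * u t x)) - pint ?r
      = pint (\<lambda>x. \<phi>\<^sub>x\<^sub>x t x * (q t x * u t x) - ?r x)"
    by (intro pint_diff[symmetric] c)
  ultimately have "pint (\<lambda>x. (\<rho>\<^sub>t t x * u t x + \<rho> t x * u\<^sub>t t x) * \<phi>\<^sub>x t x)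
      = pint (\<lambda>x. \<phi>\<^sub>x\<^sub>x t x * (q t x * u t x) - ?r x)"
    using 1 by (simp add: pint_minus)
  also have "\<dots> \<le> pint (\<lambda>x. (exp 2 + \<nu>\<^sup>2 / 2) * (\<rho> t x * (u t x)\<^sup>2) - \<rho>\<^sub>m / 2 * (\<phi>\<^sub>x t x)\<^sup>2)"
  proof (intro pint_mono c)
    fix x
    have r0: "\<rho> t x > 0" by (rule rho_pos[OF t0])
    have "\<phi>\<^sub>x\<^sub>x t x \<le> exp (\<phi> t x)" using r0 by (simp add: poisson_eq[OF t0])
    also have "\<dots> \<le> exp 2" using phi_le_2[OF t0, of x] by simp
    finally have "\<phi>\<^sub>x\<^sub>x t x * (\<rho> t x * (u t x)\<^sup>2) \<le> exp 2 * (\<rho> t x * (u t x)\<^sup>2)"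
      using r0 by (intro mult_right_mono) auto
    moreover have qu: "q t x * u t x = \<rho> t x * (u t x)\<^sup>2" by (simp add: q_def power2_eq_square)
    moreover have "- ?r x \<le> \<nu>\<^sup>2 / 2 * (\<rho> t x * (u t x)\<^sup>2) - \<rho>\<^sub>m / 2 * (\<phi>\<^sub>x t x)\<^sup>2"
    proof -
      have "0 \<le> \<rho> t x / 2 * (\<nu> * u t x + \<phi>\<^sub>x t x)\<^sup>2" using r0 by simp
      also have "\<dots> = \<nu>\<^sup>2 / 2 * (\<rho> t x * (u t x)\<^sup>2) - \<rho> t x / 2 * (\<phi>\<^sub>x t x)\<^sup>2 + ?r x"
        by (simp add: q_def power2_eq_square field_simps)
      finally have "- ?r x \<le> \<nu>\<^sup>2 / 2 * (\<rho> t x * (u t x)\<^sup>2) - \<rho> t x / 2 * (\<phi>\<^sub>x t x)\<^sup>2" by linarith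
      moreover have "\<rho>\<^sub>m / 2 * (\<phi>\<^sub>x t x)\<^sup>2 \<le> \<rho> t x / 2 * (\<phi>\<^sub>x t x)\<^sup>2"
        using rho_bounds[OF t0, of x] by (intro mult_right_mono) auto
      ultimately show ?thesis by linarith
    qed
    ultimately show "\<phi>\<^sub>x\<^sub>x t x * (q t x * u t x) - ?r x
        \<le> (exp 2 + \<nu>\<^sup>2 / 2) * (\<rho> t x * (u t x)\<^sup>2) - \<rho>\<^sub>m / 2 * (\<phi>\<^sub>x t x)\<^sup>2"
      unfolding distrib_right qu by argo
  qed
  also have "\<dots> = pint (\<lambda>x. (exp 2 + \<nu>\<^sup>2 / 2) * (\<rho> t x * (u t x)\<^sup>2)) - pint (\<lambda>x. \<rho>\<^sub>m / 2 * (\<phi>\<^sub>x t x)\<^sup>2)"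
    by (intro pint_diff c)
  finally show ?thesis unfolding pint_cmult .
qed

text \<open>The mean value theorem writes the increment of \<open>F\<close> as - h q at an
  intermediate time, and q^2 is uniformly continuous on a compact strip above
  \<open>t\<close>.\<close>

lemma q_diff_eventually:
  assumes t: "t > 0" and \<eta>: "\<eta> > 0"
  shows "eventually (\<lambda>h. pint (\<lambda>x. (q (t + h) x)\<^sup>2) \<le> pint (\<lambda>x. (q t x)\<^sup>2) + \<eta> \<and>
    pint (\<lambda>x. (F (t + h) x - F t x)\<^sup>2) \<le> h\<^sup>2 * (pint (\<lambda>x. (q t x)\<^sup>2) + \<eta>)) (at_right 0)"
proof -
  let ?K = "{t..t+1} \<times> {-1/2..1/2::real}"
  have "continuous_on ?K (\<lambda>p. ((\<lambda>(t, x). q t x) p)\<^sup>2)"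
    by (intro continuous_intros continuous_on_subset[OF joint_q]) (use t in auto)
  moreover have "compact ?K" by (intro compact_Times) auto
  ultimately have "uniformly_continuous_on ?K (\<lambda>p. ((\<lambda>(t, x). q t x) p)\<^sup>2)"
    by (rule compact_uniformly_continuous)
  then obtain d where d: "d > 0"
    "\<And>p p'. \<lbrakk>p \<in> ?K; p' \<in> ?K; dist p' p < d\<rbrakk>
      \<Longrightarrow> dist (((\<lambda>(t, x). q t x) p')\<^sup>2) (((\<lambda>(t, x). q t x) p)\<^sup>2) < \<eta>"
    unfolding uniformly_continuous_on_def using \<eta> by metis
  have close: "(q s x)\<^sup>2 \<le> (q t x)\<^sup>2 + \<eta>"
    if "t \<le> s" "s < t + min d 1" "x \<in> {-1/2..1/2}" for s x
  proof -
    have "dist (s, x) (t, x) < d" using that by (simp add: dist_Pair_Pair dist_real_def)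
    from d(2)[OF _ _ this] that have "dist ((q s x)\<^sup>2) ((q t x)\<^sup>2) < \<eta>" by simp
    thus ?thesis by (simp add: dist_real_def)
  qed
  have "eventually (\<lambda>h. h \<in> {0<..<min d 1}) (at_right (0::real))"
    using d(1) by (intro eventually_at_right_real) auto
  thus ?thesis
  proof eventually_elim
    case (elim h)
    have s: "t + h \<ge> 0" "t \<ge> 0" using elim t by auto
    note c = continuous_intros slice_q F_continuous_x s
    have c1: "continuous_on UNIV (\<lambda>x. (q t x)\<^sup>2 + \<eta>)" by (intro c)
    have R: "pint (\<lambda>x. (q t x)\<^sup>2 + \<eta>) = pint (\<lambda>x. (q t x)\<^sup>2) + \<eta>"
      by (subst pint_add) (auto intro!: c)
    have "pint (\<lambda>x. (q (t + h) x)\<^sup>2) \<le> pint (\<lambda>x. (q t x)\<^sup>2 + \<eta>)"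
      by (intro pint_mono c close) (use elim in auto)
    moreover have "pint (\<lambda>x. (F (t + h) x - F t x)\<^sup>2) \<le> pint (\<lambda>x. h\<^sup>2 * ((q t x)\<^sup>2 + \<eta>))"
    proof (intro pint_mono c)
      fix x :: real assume x: "x \<in> {-1/2..1/2}"
      have "t < t + h" using elim by simp
      from MVT2[OF this, of "\<lambda>s. F s x" "\<lambda>s. - q s x"] F_t t
      obtain z where z: "t < z" "z < t + h" "F (t + h) x - F t x = h * - q z x"
        by (auto simp: less_le_trans)
      have "(F (t + h) x - F t x)\<^sup>2 = h\<^sup>2 * (q z x)\<^sup>2" unfolding z(3) by (simp add: power_mult_distrib)
      also have "\<dots> \<le> h\<^sup>2 * ((q t x)\<^sup>2 + \<eta>)"
        using z elim x by (intro mult_left_mono close) auto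
      finally show "(F (t + h) x - F t x)\<^sup>2 \<le> h\<^sup>2 * ((q t x)\<^sup>2 + \<eta>)" .
    qed
    ultimately show ?case unfolding pint_cmult R by simp
  qed
qed

section \<open>The Lyapunov functional and its decay\<close>

abbreviation eps :: real where "eps \<equiv> energy_eps \<nu> \<rho>\<^sub>p"

definition lyapunov :: "real \<Rightarrow> real" where
  "lyapunov t = kinetic t + potential t + eps * cross t"

lemma lyapunov_bounds:
  assumes t: "t \<ge> 0"
  shows "lyapunov t \<le> 3 / 2 * (kinetic t + potential t)" "kinetic t + potential t \<le> 2 * lyapunov t"
proof -
  note e = energy_constants_pos[OF nu_pos rhop_pos]
  note b = potential_bounds(1)[OF t] k_int_nonneg[OF t] w_int_nonneg[OF t]
  have "1 / 2 * k_int t + \<rho>\<^sub>p / 2 * w_int t \<le> (1 + \<rho>\<^sub>p) * (kinetic t + potential t)"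
  proof -
    have "\<rho>\<^sub>p * (1 / 2 * w_int t) \<le> \<rho>\<^sub>p * potential t" using b rhop_pos by (intro mult_left_mono) auto
    moreover have "0 \<le> \<rho>\<^sub>p * k_int t" "0 \<le> potential t" using b rhop_pos by auto
    moreover have "(1 + \<rho>\<^sub>p) * (kinetic t + potential t) = 1 / 2 * k_int t + \<rho>\<^sub>p / 2 * w_int t
        + (1 / 2 * (\<rho>\<^sub>p * k_int t) + potential t + (\<rho>\<^sub>p * potential t - \<rho>\<^sub>p * (1 / 2 * w_int t)))"
      unfolding kinetic_eq by (simp add: field_simps)
    ultimately show ?thesis by argo
  qed
  with cross_bound[OF t] have "\<bar>cross t\<bar> \<le> (1 + \<rho>\<^sub>p) * (kinetic t + potential t)" by linarith
  hence "eps * \<bar>cross t\<bar> \<le> eps * (1 + \<rho>\<^sub>p) * (kinetic t + potential t)"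
    using e(2) by (simp add: mult.assoc)
  also have "\<dots> \<le> 1 / 2 * (kinetic t + potential t)"
    using e(3) b by (intro mult_right_mono) (auto simp: kinetic_eq)
  finally have "\<bar>eps * cross t\<bar> \<le> 1 / 2 * (kinetic t + potential t)"
    using e(2) by (simp add: abs_mult)
  thus "lyapunov t \<le> 3 / 2 * (kinetic t + potential t)" "kinetic t + potential t \<le> 2 * lyapunov t"
    unfolding lyapunov_def abs_le_iff by argo+
qed

lemma lyapunov_rate:
  assumes t: "t \<ge> 0"
  shows "- \<nu> * k_int t + eps * ((exp 2 + \<nu>\<^sup>2 / 2) * k_int t - \<rho>\<^sub>m / 2 * w_int t) + eps * (\<rho>\<^sub>p * k_int t)
    \<le> - energy_rate \<nu> \<rho>\<^sub>m \<rho>\<^sub>p * lyapunov t"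
proof -
  note e = energy_constants_pos[OF nu_pos rhop_pos]
  note b = k_int_nonneg[OF t] w_int_nonneg[OF t]
  define m where "m = min \<nu> (eps * \<rho>\<^sub>m / (1 + exp 4))"
  have e4: "(1::real) + exp 4 > 0" by (simp add: add_pos_pos)
  have m: "m > 0" "m \<le> \<nu>" using nu_pos e(2) rhom_pos e4 by (auto simp: m_def)
  have "m \<le> eps * \<rho>\<^sub>m / (1 + exp 4)" unfolding m_def by (rule min.cobounded2)
  hence m2: "m * (1 + exp 4) \<le> eps * \<rho>\<^sub>m" using e4 by (simp add: pos_le_divide_eq)
  have "energy_rate \<nu> \<rho>\<^sub>m \<rho>\<^sub>p * lyapunov t \<le> 2 / 3 * m * (3 / 2 * (kinetic t + potential t))"
    unfolding energy_rate_def m_def[symmetric]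
    using m lyapunov_bounds(1)[OF t] by (intro mult_left_mono) auto
  also have "\<dots> = 1 / 2 * (m * k_int t) + m * potential t" unfolding kinetic_eq by (simp add: field_simps)
  also have "\<dots> \<le> 1 / 2 * (\<nu> * k_int t) + m * ((1 + exp 4) / 2 * w_int t)"
    using potential_bounds(2)[OF t] m b by (intro add_mono mult_left_mono mult_right_mono) auto
  also have "m * ((1 + exp 4) / 2 * w_int t) = 1 / 2 * (m * (1 + exp 4) * w_int t)" by (simp add: field_simps)
  also have "1 / 2 * (\<nu> * k_int t) + \<dots> \<le> 1 / 2 * (\<nu> * k_int t) + 1 / 2 * (eps * \<rho>\<^sub>m * w_int t)"
    using m2 b by (intro add_mono mult_left_mono mult_right_mono) auto
  finally have 1: "energy_rate \<nu> \<rho>\<^sub>m \<rho>\<^sub>p * lyapunov t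
    \<le> 1 / 2 * (\<nu> * k_int t) + 1 / 2 * (eps * \<rho>\<^sub>m * w_int t)" .
  have "eps * energy_coeff \<nu> \<rho>\<^sub>p * k_int t \<le> \<nu> / 2 * k_int t"
    using e(4) b by (intro mult_right_mono) auto
  hence 2: "eps * (exp 2 + \<nu>\<^sup>2 / 2 + \<rho>\<^sub>p) * k_int t \<le> 1 / 2 * (\<nu> * k_int t)"
    unfolding energy_coeff_def by simp
  have "- \<nu> * k_int t + eps * ((exp 2 + \<nu>\<^sup>2 / 2) * k_int t - \<rho>\<^sub>m / 2 * w_int t) + eps * (\<rho>\<^sub>p * k_int t)
    = - (\<nu> * k_int t) + eps * (exp 2 + \<nu>\<^sup>2 / 2 + \<rho>\<^sub>p) * k_int t - 1 / 2 * (eps * \<rho>\<^sub>m * w_int t)"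
    by (simp add: field_simps)
  with 1 2 show ?thesis by argo
qed

lemma lyapunov_Dini:
  assumes t: "t > 0" and \<eta>: "\<eta> > 0"
  shows "eventually (\<lambda>h. lyapunov (t + h) \<le> lyapunov t + h * (\<eta> - energy_rate \<nu> \<rho>\<^sub>m \<rho>\<^sub>p * lyapunov t))
    (at_right 0)"
proof -
  have t0: "t \<ge> 0" using t by simp
  note e = energy_constants_pos[OF nu_pos rhop_pos]
  note j = joint_pos[unfolded case_prod_unfold] joint_pos'[unfolded case_prod_unfold]
    joint_q[unfolded case_prod_unfold]
  have jq: "continuous_on ({0<..} \<times> UNIV) (\<lambda>(t, x). q t x)"
    by (rule continuous_on_subset[OF joint_q]) auto
  have jf: "continuous_on ({0<..} \<times> UNIV) (\<lambda>p. f (snd p))" if "continuous_on UNIV f" for f :: "real \<Rightarrow> real"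
    by (rule continuous_on_compose2[OF that]) (auto intro!: continuous_intros)
  define R where "R = pint (\<lambda>x. (q t x)\<^sup>2)"
  define c0 :: real where "c0 = 1 / 2 + exp 6 / 2"
  \<comment> \<open>With \<phi>_x frozen at time t, \<Psi> is differentiable. The increment
    estimates bound the growth of \<open>lyapunov\<close> by that of \<Psi> plus
    \<open>eps * h * R\<close>, up to o(h).\<close>
  define \<Psi> where "\<Psi> s = kinetic s - pint (\<lambda>x. \<phi>\<^sub>x t x * F s x) + eps * pint (\<lambda>x. q s x * \<phi>\<^sub>x t x)" for s
  define \<Psi>' where "\<Psi>' = pint (\<lambda>x. 1 / 2 * (\<rho>\<^sub>t t x * (u t x)\<^sup>2) + q t x * u\<^sub>t t x)
    - pint (\<lambda>x. - (\<phi>\<^sub>x t x * q t x)) + eps * pint (\<lambda>x. (\<rho>\<^sub>t t x * u t x + \<rho> t x * u\<^sub>t t x) * \<phi>\<^sub>x t x)"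
  \<comment> \<open>The work of the field, lost by the kinetic part, is regained by the potential
    part and cancels.\<close>
  have "\<Psi>' = - \<nu> * k_int t + eps * pint (\<lambda>x. (\<rho>\<^sub>t t x * u t x + \<rho> t x * u\<^sub>t t x) * \<phi>\<^sub>x t x)"
    unfolding \<Psi>'_def kinetic_rate[OF t] pint_minus by (simp add: cross_def mult.commute)
  hence "\<Psi>' + eps * R = - \<nu> * k_int t + eps * pint (\<lambda>x. (\<rho>\<^sub>t t x * u t x + \<rho> t x * u\<^sub>t t x) * \<phi>\<^sub>x t x)
      + eps * R" by simp
  also have "\<dots> \<le> - \<nu> * k_int t + eps * ((exp 2 + \<nu>\<^sup>2 / 2) * k_int t - \<rho>\<^sub>m / 2 * w_int t)
      + eps * (\<rho>\<^sub>p * k_int t)"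
    unfolding R_def using e(2) by (intro add_mono mult_left_mono order_refl cross_rate q_power2_le t t0) auto
  also note lyapunov_rate[OF t0]
  finally have rate: "\<Psi>' + eps * R \<le> - energy_rate \<nu> \<rho>\<^sub>m \<rho>\<^sub>p * lyapunov t" .
  have d\<Psi>: "(\<Psi> has_real_derivative \<Psi>') (at t)"
  proof -
    have "(kinetic has_real_derivative pint (\<lambda>x. 1 / 2 * (\<rho>\<^sub>t t x * (u t x)\<^sup>2) + q t x * u\<^sub>t t x)) (at t)"
      unfolding kinetic_def
    proof (rule leibniz_pint[of "{0<..}" t "\<lambda>s x. 1 / 2 * (\<rho> s x * (u s x)\<^sup>2)"
          "\<lambda>s x. 1 / 2 * (\<rho>\<^sub>t s x * (u s x)\<^sup>2) + q s x * u\<^sub>t s x"])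
      show "((\<lambda>s. 1 / 2 * (\<rho> s x * (u s x)\<^sup>2)) has_real_derivative
          1 / 2 * (\<rho>\<^sub>t s x * (u s x)\<^sup>2) + q s x * u\<^sub>t s x) (at s)" if "s \<in> {0<..}" for s x
        using that by (auto intro!: derivative_eq_intros deriv_pos simp: q_def field_simps)
      show "continuous_on ({0<..} \<times> UNIV) (\<lambda>(s, x). 1 / 2 * (\<rho>\<^sub>t s x * (u s x)\<^sup>2) + q s x * u\<^sub>t s x)"
        unfolding case_prod_unfold by (intro continuous_intros j jq[unfolded case_prod_unfold])
      show "continuous_on UNIV (\<lambda>x. 1 / 2 * (\<rho> s x * (u s x)\<^sup>2))" if "s \<in> {0<..}" for s
        using that by (intro continuous_intros slice) auto
    qed (use t in auto)
    moreover have "((\<lambda>s. pint (\<lambda>x. \<phi>\<^sub>x t x * F s x)) has_real_derivative pint (\<lambda>x. - (\<phi>\<^sub>x t x * q t x))) (at t)"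
    proof (rule leibniz_pint[of "{0<..}" t "\<lambda>s x. \<phi>\<^sub>x t x * F s x" "\<lambda>s x. - (\<phi>\<^sub>x t x * q s x)"])
      show "((\<lambda>s. \<phi>\<^sub>x t x * F s x) has_real_derivative - (\<phi>\<^sub>x t x * q s x)) (at s)" if "s \<in> {0<..}" for s x
        using that by (auto intro!: derivative_eq_intros F_t)
      show "continuous_on ({0<..} \<times> UNIV) (\<lambda>(s, x). - (\<phi>\<^sub>x t x * q s x))"
        unfolding case_prod_unfold
        by (intro continuous_intros jq[unfolded case_prod_unfold] jf slice t0)
      show "continuous_on UNIV (\<lambda>x. \<phi>\<^sub>x t x * F s x)" if "s \<in> {0<..}" for s
        using that t0 by (intro continuous_intros slice F_continuous_x) auto
    qed (use t in auto)
    moreover have "((\<lambda>s. pint (\<lambda>x. q s x * \<phi>\<^sub>x t x)) has_real_derivative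
        pint (\<lambda>x. (\<rho>\<^sub>t t x * u t x + \<rho> t x * u\<^sub>t t x) * \<phi>\<^sub>x t x)) (at t)"
    proof (rule leibniz_pint[of "{0<..}" t "\<lambda>s x. q s x * \<phi>\<^sub>x t x"
          "\<lambda>s x. (\<rho>\<^sub>t s x * u s x + \<rho> s x * u\<^sub>t s x) * \<phi>\<^sub>x t x"])
      show "((\<lambda>s. q s x * \<phi>\<^sub>x t x) has_real_derivative
          (\<rho>\<^sub>t s x * u s x + \<rho> s x * u\<^sub>t s x) * \<phi>\<^sub>x t x) (at s)" if "s \<in> {0<..}" for s x
        unfolding q_def using that by (auto intro!: derivative_eq_intros deriv_pos)
      show "continuous_on ({0<..} \<times> UNIV) (\<lambda>(s, x). (\<rho>\<^sub>t s x * u s x + \<rho> s x * u\<^sub>t s x) * \<phi>\<^sub>x t x)"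
        unfolding case_prod_unfold by (intro continuous_intros j jf slice t0)
      show "continuous_on UNIV (\<lambda>x. q s x * \<phi>\<^sub>x t x)" if "s \<in> {0<..}" for s
        using that t0 by (intro continuous_intros slice slice_q) auto
    qed (use t in auto)
    ultimately show ?thesis
      unfolding \<Psi>_def \<Psi>'_def by (intro DERIV_add DERIV_diff DERIV_cmult)
  qed
  \<comment> \<open>Three errors share \<eta>: the difference quotient of \<Psi>, the quadratic
    remainder \<open>c0 * P\<close>, and the increment of the cross term.\<close>
  define \<eta>' where "\<eta>' = \<eta> / 3"
  have \<eta>': "\<eta>' > 0" using \<eta> by (simp add: \<eta>'_def)
  have c1: "continuous_on UNIV (\<lambda>x. (q t x)\<^sup>2)" by (intro continuous_intros slice_q t0)
  have R: "R \<ge> 0" unfolding R_def by (intro pint_nonneg c1) auto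
  have c0: "c0 > 0" unfolding c0_def by (simp add: add_pos_pos)
  have "((\<lambda>h. (\<Psi> (t + h) - \<Psi> t) / h) \<longlongrightarrow> \<Psi>') (at_right 0)"
    using d\<Psi> unfolding DERIV_def by (rule tendsto_mono[rotated]) (simp add: at_le)
  hence "eventually (\<lambda>h. (\<Psi> (t + h) - \<Psi> t) / h < \<Psi>' + \<eta>') (at_right 0)"
    using \<eta>' by (intro order_tendstoD(2)) auto
  \<comment> \<open>For such h the quadratic remainder \<open>c0 * P\<close> is at most h *
    \<eta>'.\<close>
  moreover have "eventually (\<lambda>h. h \<in> {0<..<\<eta>' / (c0 * (R + \<eta>'))}) (at_right 0)"
    using \<eta>' c0 R by (intro eventually_at_right_real) auto
  moreover note q_diff_eventually[OF t \<eta>', folded R_def]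
  ultimately show ?thesis
  proof eventually_elim
    case (elim h)
    have h: "h > 0" "h < \<eta>' / (c0 * (R + \<eta>'))" using elim by auto
    define P where "P = pint (\<lambda>x. (F (t + h) x - F t x)\<^sup>2)"
    have P: "P \<le> h\<^sup>2 * (R + \<eta>')" using elim by (simp add: P_def)
    have s0: "t + h \<ge> 0" using t h by simp
    have Psi: "\<Psi> (t + h) - \<Psi> t \<le> h * (\<Psi>' + \<eta>')"
      using elim(1) h by (simp add: pos_divide_less_eq mult.commute)
    have "h * (c0 * (R + \<eta>')) \<le> \<eta>'"
      using h c0 R \<eta>' by (simp add: pos_less_divide_eq)
    hence "h * (h * (c0 * (R + \<eta>'))) \<le> h * \<eta>'" using h by (intro mult_left_mono) auto
    moreover have "c0 * P \<le> c0 * (h\<^sup>2 * (R + \<eta>'))" using P c0 by (intro mult_left_mono) auto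
    ultimately have cP: "c0 * P \<le> h * \<eta>'" by (simp add: power2_eq_square algebra_simps)
    have "1 / (2 * h) * P \<le> 1 / (2 * h) * (h\<^sup>2 * (R + \<eta>'))"
      using P h by (intro mult_left_mono) auto
    also have "\<dots> = h / 2 * (R + \<eta>')" using h by (simp add: power2_eq_square)
    finally have P2: "1 / (2 * h) * P \<le> h / 2 * (R + \<eta>')" .
    have q2: "h / 2 * pint (\<lambda>x. (q (t + h) x)\<^sup>2) \<le> h / 2 * (R + \<eta>')"
      using elim h by (intro mult_left_mono) auto
    have "cross (t + h) - cross t \<le> pint (\<lambda>x. q (t + h) x * \<phi>\<^sub>x t x) - pint (\<lambda>x. q t x * \<phi>\<^sub>x t x)
        + h * (R + \<eta>')"
    proof -
      have "cross (t + h) - cross t \<le> pint (\<lambda>x. q (t + h) x * \<phi>\<^sub>x t x) - pint (\<lambda>x. q t x * \<phi>\<^sub>x t x)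
          + h / 2 * pint (\<lambda>x. (q (t + h) x)\<^sup>2) + 1 / (2 * h) * P"
        using cross_diff_le[OF t0, of "t + h"] h unfolding P_def by simp
      also have "\<dots> \<le> pint (\<lambda>x. q (t + h) x * \<phi>\<^sub>x t x) - pint (\<lambda>x. q t x * \<phi>\<^sub>x t x)
          + h / 2 * (R + \<eta>') + h / 2 * (R + \<eta>')"
        by (intro add_mono order_refl P2 q2)
      finally show ?thesis by (simp add: field_simps)
    qed
    hence "eps * (cross (t + h) - cross t) \<le> eps * (pint (\<lambda>x. q (t + h) x * \<phi>\<^sub>x t x) - pint (\<lambda>x. q t x * \<phi>\<^sub>x t x)
        + h * (R + \<eta>'))"
      using e(2) by (intro mult_left_mono) auto
    moreover have "potential (t + h) - potential t
        \<le> - (pint (\<lambda>x. \<phi>\<^sub>x t x * F (t + h) x) - pint (\<lambda>x. \<phi>\<^sub>x t x * F t x)) + c0 * P"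
    proof -
      have "pint (\<lambda>x. \<phi>\<^sub>x t x * (F (t + h) x - F t x))
          = pint (\<lambda>x. \<phi>\<^sub>x t x * F (t + h) x) - pint (\<lambda>x. \<phi>\<^sub>x t x * F t x)"
        unfolding right_diff_distrib by (intro pint_diff continuous_intros slice F_continuous_x t0 s0)
      thus ?thesis using potential_diff_le[OF t0 s0] by (simp add: P_def c0_def)
    qed
    ultimately have "lyapunov (t + h) - lyapunov t
        \<le> (\<Psi> (t + h) - \<Psi> t) + c0 * P + eps * (h * (R + \<eta>'))"
      unfolding lyapunov_def \<Psi>_def by (simp add: algebra_simps)
    also have "\<dots> \<le> h * (\<Psi>' + \<eta>') + h * \<eta>' + eps * (h * (R + \<eta>'))"
      using Psi cP by linarith
    also have "\<dots> = h * (\<Psi>' + eps * R) + h * (2 * \<eta>' + eps * \<eta>')" by (simp add: algebra_simps)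
    also have "\<dots> \<le> h * (- energy_rate \<nu> \<rho>\<^sub>m \<rho>\<^sub>p * lyapunov t) + h * (2 * \<eta>' + 1 * \<eta>')"
    proof -
      have "eps * 1 \<le> eps * (1 + \<rho>\<^sub>p)" using e(2) rhop_pos by (intro mult_left_mono) auto
      hence "eps \<le> 1" using e(3) by simp
      thus ?thesis using rate h \<eta>' by (intro add_mono mult_left_mono mult_right_mono order_refl) auto
    qed
    also have "\<dots> = h * (\<eta> - energy_rate \<nu> \<rho>\<^sub>m \<rho>\<^sub>p * lyapunov t)" by (simp add: \<eta>'_def algebra_simps)
    finally show ?case by simp
  qed
qed

lemma lyapunov_continuous: "continuous_on {0..} lyapunov"
  unfolding lyapunov_def kinetic_def potential_def cross_def pint_def q_def
  by (intro continuous_intros continuous_on_integral_param; unfold case_prod_unfold;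
      intro continuous_intros joint[unfolded case_prod_unfold])

lemma free_energy_decay:
  assumes t: "t \<ge> 0"
  shows "free_energy \<rho> u \<phi> t \<le> 3 * free_energy \<rho> u \<phi> 0 * exp (- energy_rate \<nu> \<rho>\<^sub>m \<rho>\<^sub>p * t)"
proof -
  have "free_energy \<rho> u \<phi> t \<le> 2 * lyapunov t"
    using lyapunov_bounds(2)[OF t] free_energy_eq[OF t] by simp
  also have "lyapunov t \<le> lyapunov 0 * exp (- energy_rate \<nu> \<rho>\<^sub>m \<rho>\<^sub>p * t)"
    by (rule Dini_Gronwall[OF lyapunov_continuous t lyapunov_Dini])
  also have "\<dots> \<le> 3 / 2 * free_energy \<rho> u \<phi> 0 * exp (- energy_rate \<nu> \<rho>\<^sub>m \<rho>\<^sub>p * t)"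
    using lyapunov_bounds(1)[of 0] free_energy_eq[of 0] by (intro mult_right_mono) auto
  finally show ?thesis by simp
qed

lemma k_w_int_decay:
  assumes t: "t \<ge> 0"
  shows "k_int t \<le> 6 * free_energy \<rho> u \<phi> 0 * exp (- energy_rate \<nu> \<rho>\<^sub>m \<rho>\<^sub>p * t)"
    "w_int t \<le> 6 * free_energy \<rho> u \<phi> 0 * exp (- energy_rate \<nu> \<rho>\<^sub>m \<rho>\<^sub>p * t)"
  using free_energy_decay[OF t] free_energy_eq[OF t] kinetic_eq[of t] potential_bounds(1)[OF t]
    k_int_nonneg[OF t] w_int_nonneg[OF t] by argo+

end

section \<open>Characteristics\<close>

text \<open>Dividing by y - x and letting y decrease to x is how two characteristics are made to
  merge.\<close>

lemma deriv_le_of_increment_le: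
  assumes f: "(f has_real_derivative f') (at x)" and g: "(g has_real_derivative g') (at x)"
    and le: "\<And>y. y > x \<Longrightarrow> \<bar>f y - f x\<bar> \<le> K * (g y - g x)"
  shows "\<bar>f'\<bar> \<le> K * g'"
proof -
  have lim: "((\<lambda>y. (h y - h x) / (y - x)) \<longlongrightarrow> h') (at_right x)"
    if "(h has_real_derivative h') (at x)" for h :: "real \<Rightarrow> real" and h'
    using that unfolding has_field_derivative_iff by (rule tendsto_mono[rotated]) (simp add: at_le)
  show ?thesis
  proof (rule tendsto_le)
    show "((\<lambda>y. \<bar>(f y - f x) / (y - x)\<bar>) \<longlongrightarrow> \<bar>f'\<bar>) (at_right x)" by (intro tendsto_rabs lim f)
    show "((\<lambda>y. K * ((g y - g x) / (y - x))) \<longlongrightarrow> K * g') (at_right x)"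
      by (intro tendsto_mult tendsto_const lim g)
    show "eventually (\<lambda>y. \<bar>(f y - f x) / (y - x)\<bar> \<le> K * ((g y - g x) / (y - x))) (at_right x)"
      using eventually_at_right_less
    proof eventually_elim
      case (elim y)
      have "\<bar>f y - f x\<bar> / (y - x) \<le> K * (g y - g x) / (y - x)"
        using elim by (intro divide_right_mono le) auto
      thus ?case using elim by (simp add: abs_divide)
    qed
  qed simp
qed

text \<open>The part of \<open>U\<close> where \<bar>f\<bar> exceeds \<open>M\<close> is open and
  null, hence empty. Continuity extends the bound to the closure, which brings in the initial time
  and the endpoints of the period.\<close>

lemma Linfty_norm_bound_pointwise:
  fixes f :: "'a::euclidean_space \<Rightarrow> real"
  assumes c: "continuous_on (closure U) f" and U: "open U" "U \<subseteq> S" and S: "S \<in> sets lebesgue"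
    and le: "Linfty_norm S f \<le> ereal M" and z: "z \<in> closure U"
  shows "\<bar>f z\<bar> \<le> M"
proof -
  have "AE y in lebesgue_on S. ereal \<bar>f y\<bar> \<le> esssup (lebesgue_on S) (\<lambda>z. ereal \<bar>f z\<bar>)"
    by (rule esssup_AE)
  hence "AE y in lebesgue_on S. \<bar>f y\<bar> \<le> M"
  proof (rule eventually_mono)
    fix y assume "ereal \<bar>f y\<bar> \<le> esssup (lebesgue_on S) (\<lambda>z. ereal \<bar>f z\<bar>)"
    from order_trans[OF this le[unfolded Linfty_norm_def]] show "\<bar>f y\<bar> \<le> M" by simp
  qed
  hence "AE y in lebesgue. y \<in> S \<longrightarrow> \<bar>f y\<bar> \<le> M"
    using S by (subst (asm) AE_restrict_space_iff) auto
  then obtain N where N: "N \<in> null_sets lebesgue" "{y. \<not> (y \<in> S \<longrightarrow> \<bar>f y\<bar> \<le> M)} \<subseteq> N"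
    unfolding eventually_ae_filter by auto
  have cU: "continuous_on U f" by (rule continuous_on_subset[OF c closure_subset])
  define V where "V = U \<inter> (\<lambda>y. \<bar>f y\<bar>) -` {M<..}"
  have "open V" unfolding V_def
    by (rule continuous_open_preimage) (auto intro!: continuous_intros cU U)
  moreover have "negligible V"
    by (rule negligible_subset[of N]) (use N U in \<open>auto simp: V_def negligible_iff_null_sets\<close>)
  ultimately have "V = {}" using open_not_negligible by blast
  hence "\<forall>y\<in>U. norm (f y) \<le> M" by (auto simp: V_def not_less[symmetric])
  with continuous_on_closure_norm_le[OF c this z] show ?thesis by simp
qed

lemma Linfty_norm_torus_le:
  assumes "continuous_on UNIV f" "\<And>x. x \<in> torus \<Longrightarrow> \<bar>f x\<bar> \<le> c"
  shows "Linfty_norm torus f \<le> ereal c"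
  unfolding Linfty_norm_def
proof (rule esssup_I)
  have T: "torus \<in> sets lebesgue" by (simp add: torus_def)
  have "(\<lambda>x. \<bar>f x\<bar>) \<in> borel_measurable (lebesgue_on torus)"
    by (intro continuous_imp_measurable_on_sets_lebesgue T continuous_intros
          continuous_on_subset[OF assms(1)]) auto
  thus "(\<lambda>x. ereal \<bar>f x\<bar>) \<in> borel_measurable (lebesgue_on torus)" by simp
  show "AE x in lebesgue_on torus. ereal \<bar>f x\<bar> \<le> ereal c"
    by (rule AE_I2) (auto intro: assms(2) simp: space_restrict_space)
qed

context euler_poisson
begin

section \<open>Mass labels and the characteristics as level curves\<close>

lemma F_increment:
  assumes t: "t \<ge> 0" and xy: "x \<le> y"
  shows "\<rho>\<^sub>m * (y - x) \<le> F t y - F t x" "F t y - F t x \<le> \<rho>\<^sub>p * (y - x)"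
proof -
  have "\<rho>\<^sub>m * (y - x) \<le> F t y - F t x \<and> F t y - F t x \<le> \<rho>\<^sub>p * (y - x)"
  proof (cases "x = y")
    case False
    hence "x < y" using xy by simp
    from MVT2[OF this, of "F t" "\<rho> t"] F_x[OF t] obtain z where
      "F t y - F t x = (y - x) * \<rho> t z" by blast
    thus ?thesis using rho_bounds[OF t, of z] \<open>x < y\<close>
      by (auto simp: mult.commute intro!: mult_right_mono)
  qed simp
  thus "\<rho>\<^sub>m * (y - x) \<le> F t y - F t x" "F t y - F t x \<le> \<rho>\<^sub>p * (y - x)" by auto
qed

lemma F_strict_mono: "\<lbrakk>t \<ge> 0; x < y\<rbrakk> \<Longrightarrow> F t x < F t y"
  using F_increment(1)[of t x y] mult_pos_pos[OF rhom_pos, of "y - x"] by linarith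

lemma F_dist:
  assumes t: "t \<ge> 0" shows "\<rho>\<^sub>m * \<bar>x - y\<bar> \<le> \<bar>F t x - F t y\<bar>"
  using F_increment(1)[OF t, of x y] F_increment(1)[OF t, of y x]
  by (cases "x \<le> y") (auto simp: abs_if)

lemma F_level_exists:
  assumes t: "t \<ge> 0" shows "\<exists>x. F t x = m"
proof -
  define N where "N = \<bar>m - F t 0\<bar> / \<rho>\<^sub>m"
  have N: "N \<ge> 0" "\<rho>\<^sub>m * N = \<bar>m - F t 0\<bar>" using rhom_pos by (auto simp: N_def)
  have "F t (- N) \<le> m" using F_increment(1)[OF t, of "- N" 0] N by simp
  moreover have "m \<le> F t N" using F_increment(1)[OF t, of 0 N] N by simp
  ultimately show ?thesis
    using IVT'[of "F t" "- N" m N] N continuous_on_subset[OF F_continuous_x[OF t]] by auto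
qed

text \<open>The characteristic with mass label \<open>m\<close>. For t \<ge> 0 the description is
  proper, since \<rho> \<ge> \<open>\<rho>\<^sub>m\<close> > 0 makes \<open>F t\<close> a strictly
  increasing bijection.\<close>

definition X :: "real \<Rightarrow> real \<Rightarrow> real" where "X m t = (THE x. F t x = m)"

lemma X_eqI:
  assumes "t \<ge> 0" "F t x = m" shows "X m t = x"
  unfolding X_def
proof (rule the_equality)
  show "y = x" if "F t y = m" for y
    using that assms F_strict_mono[of t x y] F_strict_mono[of t y x] by (cases x y rule: linorder_cases) auto
qed fact

lemma F_X:
  assumes t: "t \<ge> 0" shows "F t (X m t) = m"
proof -
  obtain x where "F t x = m" using F_level_exists[OF t] ..
  thus ?thesis using X_eqI[OF t, of x m] by simp
qed

lemma X_less:
  assumes t: "t \<ge> 0" and ab: "a < b" shows "X a t < X b t"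
proof (rule ccontr)
  assume "\<not> X a t < X b t"
  hence "F t (X b t) \<le> F t (X a t)"
    using F_strict_mono[OF t, of "X b t" "X a t"] by (cases "X b t = X a t") auto
  thus False using ab by (simp add: F_X[OF t])
qed

text \<open>The lower density bound makes the inverse of F s Lipschitz uniformly in s, so the
  displacement of X m is controlled by the change of \<open>F\<close> at a fixed point.\<close>

lemma X_continuous: "continuous_on {0..} (X m)"
  unfolding continuous_on_def
proof
  fix t :: real assume "t \<in> {0..}"
  hence t: "t \<ge> 0" by simp
  have "((\<lambda>s. F s (X m t)) \<longlongrightarrow> F t (X m t)) (at t within {0..})"
    using F_continuous_t t by (auto simp: continuous_on_def)
  hence "((\<lambda>s. \<bar>m - F s (X m t)\<bar> / \<rho>\<^sub>m) \<longlongrightarrow> \<bar>m - F t (X m t)\<bar> / \<rho>\<^sub>m) (at t within {0..})"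
    using rhom_pos by (intro tendsto_intros) auto
  hence lim: "((\<lambda>s. \<bar>m - F s (X m t)\<bar> / \<rho>\<^sub>m) \<longlongrightarrow> 0) (at t within {0..})"
    by (simp add: F_X[OF t])
  have "eventually (\<lambda>s. s \<in> {0..}) (at t within {0..})" by (simp add: eventually_at_filter)
  hence "eventually (\<lambda>s. norm (X m s - X m t) \<le> \<bar>m - F s (X m t)\<bar> / \<rho>\<^sub>m) (at t within {0..})"
  proof eventually_elim
    case (elim s)
    thus ?case using F_dist[of s "X m s" "X m t"] rhom_pos
      by (simp add: F_X pos_le_divide_eq mult.commute)
  qed
  from Lim_null_comparison[OF this lim] show "(X m \<longlongrightarrow> X m t) (at t within {0..})"
    by (simp add: LIM_zero_iff)
qed

text \<open>Implicit differentiation gives - F_t / F_x = q / \<rho> = u.\<close>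

lemma X_deriv:
  assumes t: "t > 0" shows "(X m has_real_derivative u t (X m t)) (at t)"
proof -
  have t0: "t \<ge> 0" using t by simp
  have "isCont (X m) t"
    using continuous_on_interior[OF X_continuous, of t m] t by simp
  hence "(X m has_real_derivative - (- q t (X m t)) / \<rho> t (X m t)) (at t)"
    by (intro level_curve_derivative[of "{0<..}" t F \<rho> "X m" _ m])
       (use t F_x F_t F_X joint_pos' rho_pos[OF t0, of "X m t"] in auto)
  thus ?thesis using rho_pos[OF t0, of "X m t"] by (simp add: q_def)
qed

definition v :: "real \<Rightarrow> real \<Rightarrow> real" where "v m t = u t (X m t)"

lemma v_continuous: "continuous_on {0..} (v m)"
proof -
  have "continuous_on {0..} (\<lambda>s. (\<lambda>(t, x). u t x) (s, X m s))"
    by (rule continuous_on_compose2[OF joint(2)]) (auto intro!: continuous_intros X_continuous)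
  thus ?thesis by (simp add: v_def[abs_def])
qed

lemma v_deriv:
  assumes t: "t > 0"
  shows "(v m has_real_derivative - \<nu> * v m t - \<phi>\<^sub>x t (X m t)) (at t)"
proof -
  have "((\<lambda>s. u s (X m s)) has_real_derivative
      u\<^sub>t t (X m t) + u\<^sub>x t (X m t) * u t (X m t)) (at t)"
    by (rule moving_point_derivative[of "{0<..}"])
       (use t deriv_x deriv_pos joint_pos' X_deriv in auto)
  thus ?thesis by (simp add: v_def[abs_def] momentum_eq[OF t] mult.commute)
qed

text \<open>The energy bounds \<phi>^2, so \<phi> decays at half its rate; \<bar>\<phi>\<bar> \<le>
  2 then makes e^\<phi> - 1 at most linear in \<phi>.\<close>

lemma exp_phi_decay:
  assumes t: "t \<ge> 0"
  shows "\<bar>exp (\<phi> t x) - 1\<bar> \<le> (1 + exp 2) * (6 * \<bar>free_energy \<rho> u \<phi> 0\<bar> + 1) *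
    exp (- (energy_rate \<nu> \<rho>\<^sub>m \<rho>\<^sub>p / 2) * t)"
proof -
  define E where "E = \<bar>free_energy \<rho> u \<phi> 0\<bar>"
  define e where "e = exp (- (energy_rate \<nu> \<rho>\<^sub>m \<rho>\<^sub>p / 2) * t)"
  have e2: "exp (- energy_rate \<nu> \<rho>\<^sub>m \<rho>\<^sub>p * t) = e\<^sup>2" unfolding e_def by (simp flip: exp_double)
  have e: "e > 0" by (simp add: e_def)
  have "(\<phi> t x)\<^sup>2 \<le> w_int t" by (rule phi_power2_le[OF t])
  also have "\<dots> \<le> 6 * free_energy \<rho> u \<phi> 0 * e\<^sup>2" using k_w_int_decay(2)[OF t] unfolding e2 .
  \<comment> \<open>Replacing 6 E by a larger perfect square avoids a square root.\<close>
  also have "\<dots> \<le> (6 * E + 1)\<^sup>2 * e\<^sup>2"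
  proof (intro mult_right_mono)
    have "0 \<le> E\<^sup>2" "0 \<le> E" by (auto simp: E_def)
    moreover have "free_energy \<rho> u \<phi> 0 \<le> E" by (simp add: E_def)
    moreover have "(6 * E + 1)\<^sup>2 = 36 * E\<^sup>2 + 12 * E + 1"
      by (simp add: power2_eq_square algebra_simps)
    ultimately show "6 * free_energy \<rho> u \<phi> 0 \<le> (6 * E + 1)\<^sup>2" by linarith
  qed auto
  finally have "(\<phi> t x)\<^sup>2 \<le> ((6 * E + 1) * e)\<^sup>2" by (simp add: power_mult_distrib)
  hence phi: "\<bar>\<phi> t x\<bar> \<le> (6 * E + 1) * e"
    using e by (subst (asm) abs_le_square_iff[symmetric]) (simp add: E_def abs_mult)
  have "(\<phi> t x)\<^sup>2 = \<bar>\<phi> t x\<bar> * \<bar>\<phi> t x\<bar>" by (simp add: power2_eq_square)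
  also have "\<dots> \<le> 2 * \<bar>\<phi> t x\<bar>" using phi_le_2[OF t, of x] by (intro mult_right_mono) auto
  finally have "exp 2 / 2 * (\<phi> t x)\<^sup>2 \<le> exp 2 / 2 * (2 * \<bar>\<phi> t x\<bar>)" by (intro mult_left_mono) auto
  also have "\<dots> = exp 2 * \<bar>\<phi> t x\<bar>" by simp
  finally have "\<bar>exp (\<phi> t x) - 1 - \<phi> t x\<bar> \<le> exp 2 * \<bar>\<phi> t x\<bar>"
    using exp_remainder_le[OF phi_le_2[OF t, of x]] by linarith
  hence "\<bar>exp (\<phi> t x) - 1\<bar> \<le> \<bar>\<phi> t x\<bar> + exp 2 * \<bar>\<phi> t x\<bar>" by linarith
  also have "\<dots> = (1 + exp 2) * \<bar>\<phi> t x\<bar>" by (simp add: algebra_simps)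
  also have "\<dots> \<le> (1 + exp 2) * ((6 * E + 1) * e)" by (intro mult_left_mono phi) auto
  finally show ?thesis by (simp add: E_def e_def mult.assoc)
qed

text \<open>Two characteristics enclosing the mass \<open>m = b - a\<close> stay at a distance \<open>D\<close> with
  \<open>D'' + \<nu> D' + \<integral> e\<^sup>\<phi> = m\<close>, the integral being over the enclosed interval. As \<open>e\<^sup>\<phi> \<rightarrow> 1\<close>,
  \<open>D / m - 1\<close> solves a forced damped oscillator equation whose forcing does not depend on \<open>m\<close>.\<close>
lemma increment_decay:
  assumes M: "\<And>x. \<bar>u\<^sub>x 0 x\<bar> \<le> M"
    and osc: "oscillator_bound \<nu> a B A C r"
    and forcing: "\<And>t x. t \<ge> 0 \<Longrightarrow> \<bar>exp (\<phi> t x) - 1\<bar> \<le> \<rho>\<^sub>m * B * exp (- a * t)"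
    and A: "1 + 1 / \<rho>\<^sub>m \<le> A" "M / \<rho>\<^sub>m \<le> A"
    and t: "t \<ge> 0" and xy: "x < y"
  shows "\<bar>(y - F t y) - (x - F t x)\<bar> \<le> C * exp (- r * t) * (F t y - F t x)"
    "\<bar>u t y - u t x\<bar> \<le> C * exp (- r * t) * (F t y - F t x)"
proof -
  \<comment> \<open>The labels are read off at time t, so that the two characteristics pass through
    x and y exactly then.\<close>
  define \<alpha> where "\<alpha> = F t x"
  define \<beta> where "\<beta> = F t y"
  define m where "m = \<beta> - \<alpha>"
  have ab: "\<alpha> < \<beta>" unfolding \<alpha>_def \<beta>_def by (rule F_strict_mono[OF t xy])
  have m: "m > 0" using ab by (simp add: m_def)
  define p where "p s = (X \<beta> s - X \<alpha> s) / m - 1" for s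
  define w where "w s = (v \<beta> s - v \<alpha> s) / m" for s
  \<comment> \<open>Its derivative in z is \<phi>_xx + \<rho> - 1 = e^\<phi> - 1, so
    \<open>g\<close> is a mean of e^\<phi> - 1 over the enclosed interval times D / m.\<close>
  define \<Theta> where "\<Theta> s z = \<phi>\<^sub>x s z + F s z - z" for s z
  define g where "g s = (\<Theta> s (X \<beta> s) - \<Theta> s (X \<alpha> s)) / m" for s
  \<comment> \<open>The density is at least \<open>\<rho>\<^sub>m\<close>, so D / m is bounded
    independently of m, and so is the forcing.\<close>
  have D: "X \<beta> s - X \<alpha> s \<le> m / \<rho>\<^sub>m" if "s \<ge> 0" for s
    using F_increment(1)[OF that, of "X \<alpha> s" "X \<beta> s"] X_less[OF that ab] rhom_pos
    by (simp add: F_X that m_def pos_le_divide_eq mult.commute)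
  have g: "\<bar>g s\<bar> \<le> B * exp (- a * s)" if s: "s \<ge> 0" for s
  proof -
    have d: "(\<Theta> s has_real_derivative exp (\<phi> s z) - 1) (at z)" for z
      unfolding \<Theta>_def
      by (auto intro!: derivative_eq_intros deriv_x F_x s simp: poisson_eq[OF s])
    from MVT2[OF X_less[OF s ab], of "\<Theta> s" "\<lambda>z. exp (\<phi> s z) - 1"] d obtain z where
      z: "\<Theta> s (X \<beta> s) - \<Theta> s (X \<alpha> s) = (X \<beta> s - X \<alpha> s) * (exp (\<phi> s z) - 1)" by blast
    have "\<bar>\<Theta> s (X \<beta> s) - \<Theta> s (X \<alpha> s)\<bar> \<le> m / \<rho>\<^sub>m * (\<rho>\<^sub>m * B * exp (- a * s))"
      unfolding z abs_mult using D[OF s] X_less[OF s ab] m rhom_pos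
      by (intro mult_mono forcing s) auto
    also have "\<dots> = m * (B * exp (- a * s))" using rhom_pos by simp
    finally show ?thesis using m by (simp add: g_def abs_divide pos_divide_le_eq mult.commute)
  qed
  have "\<bar>p t\<bar> \<le> C * exp (- r * t) \<and> \<bar>w t\<bar> \<le> C * exp (- r * t)"
  proof (rule osc[unfolded oscillator_bound_def, rule_format, of p w g, OF _ t], intro conjI allI impI)
    show "continuous_on {0..} p" "continuous_on {0..} w"
      unfolding p_def w_def using m by (auto intro!: continuous_intros X_continuous v_continuous)
    show "(p has_real_derivative w s) (at s)" if "s > 0" for s
      unfolding p_def w_def v_def using m by (auto intro!: derivative_eq_intros X_deriv that)
    show "(w has_real_derivative - \<nu> * w s - p s - g s) (at s)" if s: "s > 0" for s
    proof -
      have "(w has_real_derivative ((- \<nu> * v \<beta> s - \<phi>\<^sub>x s (X \<beta> s)) - (- \<nu> * v \<alpha> s - \<phi>\<^sub>x s (X \<alpha> s))) / m) (at s)"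
        unfolding w_def using m by (intro DERIV_cdivide DERIV_diff v_deriv s)
      \<comment> \<open>The increment of \<open>F\<close> between the two characteristics is m at
        all times; after division by m it gives the constant 1 that is subtracted in
        \<open>p\<close>.\<close>
      moreover have "((- \<nu> * v \<beta> s - \<phi>\<^sub>x s (X \<beta> s)) - (- \<nu> * v \<alpha> s - \<phi>\<^sub>x s (X \<alpha> s))) / m
          = - \<nu> * w s - p s - g s"
        using m s by (simp add: w_def p_def g_def \<Theta>_def F_X field_simps) (simp add: m_def algebra_simps)
      ultimately show ?thesis by simp
    qed
    show "\<bar>g s\<bar> \<le> B * exp (- a * s)" if "s \<ge> 0" for s by (rule g[OF that])
    have "0 \<le> (X \<beta> 0 - X \<alpha> 0) / m" "(X \<beta> 0 - X \<alpha> 0) / m \<le> 1 / \<rho>\<^sub>m"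
      using D[of 0] X_less[OF _ ab, of 0] m rhom_pos by (auto simp: pos_divide_le_eq)
    thus "\<bar>p 0\<bar> \<le> A" using A(1) by (simp add: p_def abs_le_iff)
    from MVT2[OF X_less[OF order_refl ab], of "u 0" "u\<^sub>x 0"] deriv_x(1)[of 0] obtain z where
      z: "u 0 (X \<beta> 0) - u 0 (X \<alpha> 0) = (X \<beta> 0 - X \<alpha> 0) * u\<^sub>x 0 z" by blast
    have "\<bar>v \<beta> 0 - v \<alpha> 0\<bar> \<le> m / \<rho>\<^sub>m * M"
      unfolding v_def z abs_mult using D[of 0] X_less[OF order_refl ab] m rhom_pos
      by (intro mult_mono M) auto
    hence "\<bar>w 0\<bar> \<le> M / \<rho>\<^sub>m" using m by (simp add: w_def abs_divide pos_divide_le_eq mult.commute)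
    thus "\<bar>w 0\<bar> \<le> A" using A(2) by linarith
  qed
  moreover have X: "X \<alpha> t = x" "X \<beta> t = y"
    by (auto intro!: X_eqI t simp: \<alpha>_def \<beta>_def)
  then have "p t = ((y - F t y) - (x - F t x)) / m"
  proof -
    have "(y - x) / m - 1 = ((y - x) - m) / m" using m by (simp add: diff_divide_distrib)
    also have "(y - x) - m = (y - F t y) - (x - F t x)" by (simp add: m_def \<alpha>_def \<beta>_def)
    finally show ?thesis by (simp add: p_def X)
  qed
  moreover have "w t = (u t y - u t x) / m" by (simp add: w_def v_def X)
  ultimately show "\<bar>(y - F t y) - (x - F t x)\<bar> \<le> C * exp (- r * t) * (F t y - F t x)"
    "\<bar>u t y - u t x\<bar> \<le> C * exp (- r * t) * (F t y - F t x)"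
    using m by (auto simp: abs_divide pos_divide_le_eq m_def \<alpha>_def \<beta>_def)
qed

text \<open>Merging the characteristics compares the derivatives 1 - \<rho> and u_x with the
  derivative \<rho> of \<open>F\<close>; the upper density bound then replaces \<rho> by
  \<open>\<rho>\<^sub>p\<close>.\<close>

lemma rho_u_x_decay:
  assumes M: "\<And>x. \<bar>u\<^sub>x 0 x\<bar> \<le> M"
    and osc: "oscillator_bound \<nu> a B A C r" and C: "C \<ge> 0"
    and forcing: "\<And>t x. t \<ge> 0 \<Longrightarrow> \<bar>exp (\<phi> t x) - 1\<bar> \<le> \<rho>\<^sub>m * B * exp (- a * t)"
    and A: "1 + 1 / \<rho>\<^sub>m \<le> A" "M / \<rho>\<^sub>m \<le> A"
    and t: "t \<ge> 0"
  shows "\<bar>\<rho> t x - 1\<bar> \<le> C * \<rho>\<^sub>p * exp (- r * t)" "\<bar>u\<^sub>x t x\<bar> \<le> C * \<rho>\<^sub>p * exp (- r * t)"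
proof -
  note inc = increment_decay[OF M osc forcing A t]
  have d: "((\<lambda>y. y - F t y) has_real_derivative 1 - \<rho> t x) (at x)"
    by (auto intro!: derivative_eq_intros F_x t)
  have le: "C * exp (- r * t) * \<rho> t x \<le> C * \<rho>\<^sub>p * exp (- r * t)"
    using mult_right_mono[of "\<rho> t x" "\<rho>\<^sub>p" "C * exp (- r * t)"] rho_bounds[OF t, of x] C
    by (simp add: ac_simps)
  have "\<bar>1 - \<rho> t x\<bar> \<le> C * exp (- r * t) * \<rho> t x"
    by (rule deriv_le_of_increment_le[OF d F_x[OF t] inc(1)])
  with le show "\<bar>\<rho> t x - 1\<bar> \<le> C * \<rho>\<^sub>p * exp (- r * t)" by (simp add: abs_minus_commute)
  have "\<bar>u\<^sub>x t x\<bar> \<le> C * exp (- r * t) * \<rho> t x"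
    by (rule deriv_le_of_increment_le[OF deriv_x(1)[OF t] F_x[OF t] inc(2)])
  with le show "\<bar>u\<^sub>x t x\<bar> \<le> C * \<rho>\<^sub>p * exp (- r * t)" by simp
qed

section \<open>Pointwise bounds for the remaining components\<close>

lemma u_x_bound:
  assumes M: "Linfty_norm ({0..} \<times> torus) (\<lambda>(t, x). u\<^sub>x t x) \<le> ereal M" and t: "t \<ge> 0"
  shows "\<bar>u\<^sub>x t x\<bar> \<le> M"
proof (rule periodic_reduce[of "u\<^sub>x t"])
  fix x :: real assume x: "x \<in> {-1/2..1/2}"
  let ?U = "{0<..} \<times> {-1/2<..<1/2} :: (real \<times> real) set"
  have cl: "closure ?U = {0..} \<times> {-1/2..1/2}" by (simp add: closure_Times)
  have "\<bar>(\<lambda>(t, x). u\<^sub>x t x) (t, x)\<bar> \<le> M"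
  proof (rule Linfty_norm_bound_pointwise[OF _ _ _ _ M])
    show "continuous_on (closure ?U) (\<lambda>(t, x). u\<^sub>x t x)"
      unfolding cl by (rule continuous_on_subset[OF joint(3)]) auto
    show "open ?U" by (intro open_Times) auto
    show "?U \<subseteq> {0..} \<times> torus" by (auto simp: torus_def)
    have "({0..} \<times> torus :: (real \<times> real) set) \<in> sets borel"
      unfolding torus_def by (intro borel_Times) auto
    thus "({0..} \<times> torus :: (real \<times> real) set) \<in> sets lebesgue" by simp
    show "(t, x) \<in> closure ?U" unfolding cl using t x by auto
  qed
  thus "\<bar>u\<^sub>x t x\<bar> \<le> M" by simp
qed (rule periodic_u_x[OF t])

lemma phi_x_bound:
  assumes t: "t \<ge> 0" and x: "x \<in> {-1/2..1/2}" and K: "\<And>x. \<bar>\<phi>\<^sub>x\<^sub>x t x\<bar> \<le> K"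
  shows "\<bar>\<phi>\<^sub>x t x\<bar> \<le> K"
proof -
  obtain y where y: "y \<in> {-1/2..1/2}" "\<phi>\<^sub>x t y = 0" using phi_x_zero[OF t] .
  have "\<bar>\<phi>\<^sub>x t x - \<phi>\<^sub>x t y\<bar> \<le> pint (\<lambda>x. \<bar>\<phi>\<^sub>x\<^sub>x t x\<bar>)"
    by (intro diff_le_pint_abs deriv_x slice t x y)
  also have "\<dots> \<le> pint (\<lambda>x. K)" by (intro pint_mono continuous_intros slice t K)
  finally show ?thesis using y by simp
qed

text \<open>The mean of u is not prescribed, so there need be no zero to start from. The base point
  is a minimum of u^2, where the kinetic energy over the unit period bounds u.\<close>

lemma u_bound:
  assumes t: "t \<ge> 0" and x: "x \<in> {-1/2..1/2}" and K: "\<And>x. \<bar>u\<^sub>x t x\<bar> \<le> K"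
    and L: "k_int t \<le> \<rho>\<^sub>m * L\<^sup>2" "L \<ge> 0"
  shows "\<bar>u t x\<bar> \<le> K + L"
proof -
  have "continuous_on {-1/2..1/2} (\<lambda>x. (u t x)\<^sup>2)"
    by (intro continuous_intros continuous_on_subset[OF slice(2)[OF t]]) auto
  then obtain y where y: "y \<in> {-1/2..1/2}" "\<And>z. z \<in> {-1/2..1/2} \<Longrightarrow> (u t y)\<^sup>2 \<le> (u t z)\<^sup>2"
    using continuous_attains_inf[of "{-1/2..1/2::real}" "\<lambda>x. (u t x)\<^sup>2"] by auto
  have "pint (\<lambda>x. \<rho>\<^sub>m * (u t y)\<^sup>2) \<le> k_int t"
  proof (intro pint_mono continuous_intros slice t)
    fix z :: real assume "z \<in> {-1/2..1/2}"
    thus "\<rho>\<^sub>m * (u t y)\<^sup>2 \<le> \<rho> t z * (u t z)\<^sup>2"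
      using rho_bounds[OF t, of z] rhom_pos by (intro mult_mono y) auto
  qed
  hence "\<rho>\<^sub>m * (u t y)\<^sup>2 \<le> \<rho>\<^sub>m * L\<^sup>2" using L by simp
  hence uy: "\<bar>u t y\<bar> \<le> L" using rhom_pos L(2) by (simp flip: abs_le_square_iff)
  have "\<bar>u t x - u t y\<bar> \<le> pint (\<lambda>x. \<bar>u\<^sub>x t x\<bar>)"
    by (intro diff_le_pint_abs deriv_x slice t x y)
  also have "\<dots> \<le> pint (\<lambda>x. K)" by (intro pint_mono continuous_intros slice t K)
  finally show ?thesis using uy by simp
qed

end

section \<open>Uniform constants and the six estimates\<close>

theorem theorem1p4:
  fixes \<nu> \<rho>\<^sub>m \<rho>\<^sub>p M E\<^sub>0 :: real
  assumes "\<nu> > 0" and "\<rho>\<^sub>m > 0" and "\<rho>\<^sub>p > 0" and "M > 0"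
  shows "\<exists>C>0. \<exists>r>0. \<forall>\<rho> u \<phi>.
           classical_solution \<nu> \<rho> u \<phi> \<and>
           (\<forall>t\<ge>0. (LBINT x:torus. \<rho> t x) = 1) \<and>
           (\<forall>t\<ge>0. \<forall>x. \<rho>\<^sub>m \<le> \<rho> t x \<and> \<rho> t x \<le> \<rho>\<^sub>p) \<and>
           Linfty_norm ({0..} \<times> torus) (\<lambda>(t, x). partial_x u t x) \<le> ereal M \<and>
           free_energy \<rho> u \<phi> 0 = E\<^sub>0 \<longrightarrow>
           (\<forall>t\<ge>0.
              Linfty_norm_tuple torus
                [\<lambda>x. \<rho> t x - 1,
                 \<lambda>x. u t x,
                 \<lambda>x. partial_x u t x,
                 \<lambda>x. partial_x \<phi> t x,
                 \<lambda>x. partial_x (partial_x \<phi>) t x,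
                 \<lambda>x. exp (\<phi> t x) - 1]
              \<le> ereal (C * exp (- r * t)))"
proof -
  define a where "a = energy_rate \<nu> \<rho>\<^sub>m \<rho>\<^sub>p / 2"
  have a: "a > 0" using energy_rate_pos[OF assms(1-3)] by (simp add: a_def)
  \<comment> \<open>The constants precede the solution, so \<open>E\<^sub>0\<close> is an arbitrary
    real; its absolute value keeps them positive.\<close>
  define G where "G = (1 + exp 2) * (6 * \<bar>E\<^sub>0\<bar> + 1)"
  have G: "G > 0" by (auto simp: G_def intro!: mult_pos_pos add_pos_pos add_nonneg_pos)
  \<comment> \<open>The summand 1 ensures L \<ge> 1, so L^2 \<ge> L stands in for a square root of
    the kinetic energy bound.\<close>
  define L where "L = 6 * \<bar>E\<^sub>0\<bar> / \<rho>\<^sub>m + 1"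
  have L: "L > 0" using assms(2) by (auto simp: L_def intro!: add_nonneg_pos)
  \<comment> \<open>Bounds the initial rescaled distance and velocity for every enclosed
    mass.\<close>
  define A where "A = 1 + 1 / \<rho>\<^sub>m + M / \<rho>\<^sub>m"
  have A: "1 + 1 / \<rho>\<^sub>m \<le> A" "M / \<rho>\<^sub>m \<le> A" using assms by (auto simp: A_def)
  obtain C\<^sub>1 r\<^sub>1 where osc: "C\<^sub>1 > 0" "r\<^sub>1 > 0" "oscillator_bound \<nu> a (G / \<rho>\<^sub>m) A C\<^sub>1 r\<^sub>1"
    using damped_oscillator_decay[OF assms(1) a] by blast
  define r where "r = min r\<^sub>1 a"
  have r: "r > 0" "r \<le> r\<^sub>1" "r \<le> a" using osc a by (auto simp: r_def)
  \<comment> \<open>One constant for all components: the first summand covers \<rho> - 1 and u_x,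
    \<open>G\<close> covers e^\<phi> - 1, their sum \<phi>_xx and \<phi>_x, and \<open>L\<close>
    enters through u.\<close>
  define K where "K = C\<^sub>1 * \<rho>\<^sub>p + G + L"
  have K: "K > 0" using osc assms G L by (auto simp: K_def intro!: add_pos_pos)
  show ?thesis
  proof (rule exI[of _ "6 * K"], rule conjI, use K in simp, rule exI[of _ r], rule conjI, rule r(1),
      intro allI impI, elim conjE)
    fix \<rho> u \<phi> t
    assume sol: "classical_solution \<nu> \<rho> u \<phi>"
      and mass: "\<forall>t\<ge>0. (LBINT x:torus. \<rho> t x) = 1"
      and bounds: "\<forall>t\<ge>0. \<forall>x. \<rho>\<^sub>m \<le> \<rho> t x \<and> \<rho> t x \<le> \<rho>\<^sub>p"
      and M: "Linfty_norm ({0..} \<times> torus) (\<lambda>(t, x). partial_x u t x) \<le> ereal M"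
      and E0: "free_energy \<rho> u \<phi> 0 = E\<^sub>0" and t: "(0::real) \<le> t"
    interpret euler_poisson \<nu> \<rho>\<^sub>m \<rho>\<^sub>p \<rho> u \<phi>
      by unfold_locales (use assms sol mass bounds in auto)
    have forcing: "\<bar>exp (\<phi> t x) - 1\<bar> \<le> \<rho>\<^sub>m * (G / \<rho>\<^sub>m) * exp (- a * t)" if "t \<ge> 0" for t x
      using exp_phi_decay[OF that, of x] assms(2) by (simp add: G_def a_def E0)
    define e where "e = exp (- r * t)"
    have ea: "exp (- a * t) \<le> e" and er: "exp (- r\<^sub>1 * t) \<le> e"
      using r t by (auto simp: e_def mult_right_mono)
    have C1e: "C\<^sub>1 * \<rho>\<^sub>p * exp (- r\<^sub>1 * t) \<le> C\<^sub>1 * \<rho>\<^sub>p * e"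
      using er osc assms by (intro mult_left_mono) auto
    have "0 \<le> C\<^sub>1" using osc by simp
    note decay = rho_u_x_decay[OF u_x_bound[OF M order_refl] osc(3) this forcing A t]
    have b1: "\<bar>\<rho> t x - 1\<bar> \<le> C\<^sub>1 * \<rho>\<^sub>p * e" and b2: "\<bar>u\<^sub>x t x\<bar> \<le> C\<^sub>1 * \<rho>\<^sub>p * e" for x
      using decay[of x] C1e by linarith+
    have b3: "\<bar>exp (\<phi> t x) - 1\<bar> \<le> G * e" for x
    proof -
      have "G * exp (- a * t) \<le> G * e" using ea G by (intro mult_left_mono) auto
      with forcing[OF t, of x] assms(2) show ?thesis by simp
    qed
    have b4: "\<bar>\<phi>\<^sub>x\<^sub>x t x\<bar> \<le> C\<^sub>1 * \<rho>\<^sub>p * e + G * e" for x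
      using b1[of x] b3[of x] by (simp add: poisson_eq[OF t])
    have "k_int t \<le> \<rho>\<^sub>m * (L * exp (- a * t))\<^sup>2"
    proof -
      have "k_int t \<le> 6 * E\<^sub>0 * (exp (- a * t))\<^sup>2"
        using k_w_int_decay(1)[OF t] by (simp add: E0 a_def flip: exp_double)
      also have "\<dots> \<le> \<rho>\<^sub>m * L\<^sup>2 * (exp (- a * t))\<^sup>2"
      proof (intro mult_right_mono)
        have "L \<ge> 1" using assms(2) by (simp add: L_def)
        hence "\<rho>\<^sub>m * L \<le> \<rho>\<^sub>m * L\<^sup>2" using assms(2) by (simp add: power2_eq_square)
        moreover have "\<rho>\<^sub>m * L = 6 * \<bar>E\<^sub>0\<bar> + \<rho>\<^sub>m" using assms(2) by (simp add: L_def field_simps)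
        ultimately show "6 * E\<^sub>0 \<le> \<rho>\<^sub>m * L\<^sup>2" using assms(2) by linarith
      qed auto
      finally show ?thesis by (simp add: power_mult_distrib)
    qed
    hence b5: "\<bar>u t x\<bar> \<le> C\<^sub>1 * \<rho>\<^sub>p * e + L * exp (- a * t)" if "x \<in> {-1/2..1/2}" for x
      using L by (intro u_bound[OF t that b2]) auto
    have Le: "L * exp (- a * t) \<le> L * e" using ea L by (intro mult_left_mono) auto
    have pos: "0 \<le> C\<^sub>1 * \<rho>\<^sub>p * e" "0 \<le> G * e" "0 \<le> L * e"
      using osc assms G L by (auto simp: e_def)
    have Ke: "K * e = C\<^sub>1 * \<rho>\<^sub>p * e + G * e + L * e" by (simp add: K_def algebra_simps)
    have I: "x \<in> {-1/2..1/2}" if "x \<in> torus" for x using that by (auto simp: torus_def)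
    note c = continuous_intros slice t
    have "Linfty_norm torus (\<lambda>x. \<rho> t x - 1) \<le> ereal (K * e)"
      by (rule Linfty_norm_torus_le, intro c) (use b1 pos Ke in \<open>fastforce intro: order_trans\<close>)
    moreover have "Linfty_norm torus (\<lambda>x. u t x) \<le> ereal (K * e)"
    proof (rule Linfty_norm_torus_le)
      fix x assume "x \<in> torus"
      from b5[OF I[OF this]] Le pos Ke show "\<bar>u t x\<bar> \<le> K * e" by linarith
    qed (intro c)
    moreover have "Linfty_norm torus (\<lambda>x. partial_x u t x) \<le> ereal (K * e)"
      by (rule Linfty_norm_torus_le, intro c) (use b2 pos Ke in \<open>fastforce intro: order_trans\<close>)
    moreover have "Linfty_norm torus (\<lambda>x. partial_x \<phi> t x) \<le> ereal (K * e)"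
    proof (rule Linfty_norm_torus_le)
      fix x assume "x \<in> torus"
      from phi_x_bound[OF t I[OF this] b4] pos Ke show "\<bar>\<phi>\<^sub>x t x\<bar> \<le> K * e" by simp
    qed (intro c)
    moreover have "Linfty_norm torus (\<lambda>x. partial_x (partial_x \<phi>) t x) \<le> ereal (K * e)"
      by (rule Linfty_norm_torus_le, intro c) (use b4 pos Ke in \<open>fastforce intro: order_trans\<close>)
    moreover have "Linfty_norm torus (\<lambda>x. exp (\<phi> t x) - 1) \<le> ereal (K * e)"
      by (rule Linfty_norm_torus_le, intro c) (use b3 pos Ke in \<open>fastforce intro: order_trans\<close>)
    \<comment> \<open>Shaped like the unfolded list sum, trailing 0 included, so that monotonicity
      of addition applies term by term.\<close>
    moreover have "ereal (6 * K * e) = ereal (K * e) + (ereal (K * e) + (ereal (K * e) +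
        (ereal (K * e) + (ereal (K * e) + (ereal (K * e) + 0)))))"
      by (simp add: zero_ereal_def)
    ultimately show "Linfty_norm_tuple torus
                [\<lambda>x. \<rho> t x - 1,
                 \<lambda>x. u t x,
                 \<lambda>x. partial_x u t x,
                 \<lambda>x. partial_x \<phi> t x,
                 \<lambda>x. partial_x (partial_x \<phi>) t x,
                 \<lambda>x. exp (\<phi> t x) - 1]
              \<le> ereal (6 * K * exp (- r * t))"
      unfolding Linfty_norm_tuple_def e_def[symmetric]
      by (simp del: add_0_right) (intro add_mono order_refl)
  qed
qed

end
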